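(* Let $C_{abcd}$ be a Weyl tensor of Petrov type $I$ at a point of a spacetime with metric $g_{ab}$ of signature $(+,-,-,-)$, let $T_{abcd}$ be its Bel–Robinson tensor, and let $u^a$ be a future-pointing unit timelike vector. Then the following are equivalent: (i) $u_{[a}T_{b]cde}u^cu^du^e=0$; (ii) $u^a$ is the timelike member of the canonical Petrov tetrad; (iii) $u^a$ is the unique global minimum of the quartic form $t^a\mapsto T_{abcd}t^at^bt^ct^d$ restricted to future-pointing unit timelike vectors $t^a$. Moreover, the minimum value in (iii) equals $\frac{1}{16}\sum_{i=1}^3|\sigma_i|^2$, where $\sigma_1,\sigma_2,\sigma_3$ are the coefficients of the self-dual Weyl tensor in the canonical Petrov tetrad as described below.
   Context: The Bel–Robinson tensor is $T_{abcd}=\Psi_{ABCD}\bar\Psi_{A'B'C'D'}$ with $\Psi_{ABCD}$ the Weyl spinor; equivalently $T_{abcd}=\overset{+}{C}{}^p{}_{ab}{}^q\,\overset{-}{C}_{pcdq}$, where $\overset{+}{C}_{abcd}=\tfrac12(C_{abcd}-i\,{}^{*}C_{abcd})$ is the self-dual part of the Weyl tensor, ${}^*C_{abcd}$ its dual, and $\overset{-}{C}_{abcd}$ the complex conjugate of $\overset{+}{C}_{abcd}$. Given an orthonormal tetrad $v_a,x_a,y_a,z_a$ with $v_a$ timelike, set $F_{ab}=2v_{[a}x_{b]}$, $G_{ab}=2v_{[a}y_{b]}$, $H_{ab}=2v_{[a}z_{b]}$ and $\overset{+}{F}_{ab}=\tfrac12(F_{ab}-i\,{}^*F_{ab})$,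 and similarly $\overset{+}{G}_{ab},\overset{+}{H}_{ab}$. The canonical Petrov tetrad of a type $I$ Weyl tensor is the orthonormal tetrad (unique up to signs and reorderings) in which $\overset{+}{C}_{abcd}=\sigma_1\overset{+}{F}_{ab}\overset{+}{F}_{cd}+\sigma_2\overset{+}{G}_{ab}\overset{+}{G}_{cd}+\sigma_3\overset{+}{H}_{ab}\overset{+}{H}_{cd}$ for complex numbers $\sigma_i$ with $\sigma_1+\sigma_2+\sigma_3=0$ (equivalently, $E_{ab}+iB_{ab}$ is diagonal in it, where $E_{ab}=C_{acdb}v^cv^d$, $B_{ab}={}^*C_{acdb}v^cv^d$); its timelike member $v^a$ is taken future-pointing. *)

theory Defs
  imports "HOL-Analysis.Analysis"
begin

text \<open>Algebra at a single point of spacetime.  Components are taken with respect to an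
arbitrary (coordinate) basis of the tangent space, indexed by the 4-element type 4.
The metric g is a real 4x4 matrix of Lorentzian signature (+,-,-,-);
its inverse (the contravariant metric) is matrix_inv g.  Vectors u^a are contravariant
(type real^4), tensors with lower indices are functions of their indices.\<close>

type_synonym idx = 4
type_synonym rtensor4 = "idx \<Rightarrow> idx \<Rightarrow> idx \<Rightarrow> idx \<Rightarrow> real"
type_synonym ctensor4 = "idx \<Rightarrow> idx \<Rightarrow> idx \<Rightarrow> idx \<Rightarrow> complex"
type_synonym cbivector = "idx \<Rightarrow> idx \<Rightarrow> complex"

definition mink :: "idx \<Rightarrow> idx \<Rightarrow> real" where
  "mink i j = (if i = j then (if i = 0 then 1 else -1) else 0)"

definition gdot :: "real^4^4 \<Rightarrow> real^4 \<Rightarrow> real^4 \<Rightarrow> real" where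
  "gdot g v w = (\<Sum>a\<in>UNIV. \<Sum>b\<in>UNIV. g$a$b * v$a * w$b)"

definition lorentz_metric :: "real^4^4 \<Rightarrow> bool" where
  "lorentz_metric g \<longleftrightarrow> (\<forall>a b. g$a$b = g$b$a) \<and>
     (\<exists>e :: idx \<Rightarrow> real^4. \<forall>i j. gdot g (e i) (e j) = mink i j)"

definition ginv :: "real^4^4 \<Rightarrow> idx \<Rightarrow> idx \<Rightarrow> real" where
  "ginv g a b = matrix_inv g $ a $ b"

definition lower :: "real^4^4 \<Rightarrow> real^4 \<Rightarrow> idx \<Rightarrow> real" where
  "lower g v a = (\<Sum>b\<in>UNIV. g$a$b * v$b)"

text \<open>Time orientation: given by a timelike vector tau (g(tau,tau) > 0) declared future-pointing.\<close>
definition future_unit_timelike :: "real^4^4 \<Rightarrow> real^4 \<Rightarrow> real^4 \<Rightarrow> bool" where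
  "future_unit_timelike g tau t \<longleftrightarrow> gdot g t t = 1 \<and> gdot g t tau > 0"

text \<open>Levi-Civita symbol [abcd] and volume form
  eps_abcd = sqrt(|det g|) [abcd] (orientation of the coordinate basis).\<close>
definition levi_civita :: "idx \<Rightarrow> idx \<Rightarrow> idx \<Rightarrow> idx \<Rightarrow> real" where
  "levi_civita a b c d = det (\<chi> i. if i = 0 then axis a 1 else if i = 1 then axis b 1
                                 else if i = 2 then axis c 1 else (axis d 1 :: real^4))"

definition vol :: "real^4^4 \<Rightarrow> rtensor4" where
  "vol g a b c d = sqrt \<bar>det g\<bar> * levi_civita a b c d"

definition dual4 :: "real^4^4 \<Rightarrow> rtensor4 \<Rightarrow> rtensor4" where
  "dual4 g C a b c d = (1/2) * (\<Sum>p\<in>UNIV. \<Sum>q\<in>UNIV. \<Sum>r\<in>UNIV. \<Sum>s\<in>UNIV.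
      vol g a b r s * ginv g r p * ginv g s q * C p q c d)"

definition dual2 :: "real^4^4 \<Rightarrow> cbivector \<Rightarrow> cbivector" where
  "dual2 g F a b = (1/2) * (\<Sum>p\<in>UNIV. \<Sum>q\<in>UNIV. \<Sum>r\<in>UNIV. \<Sum>s\<in>UNIV.
      complex_of_real (vol g a b r s * ginv g r p * ginv g s q) * F p q)"

definition sd_weyl :: "real^4^4 \<Rightarrow> rtensor4 \<Rightarrow> ctensor4" where
  "sd_weyl g C a b c d = (1/2) * (complex_of_real (C a b c d) - \<i> * complex_of_real (dual4 g C a b c d))"

definition sd_biv :: "real^4^4 \<Rightarrow> cbivector \<Rightarrow> cbivector" where
  "sd_biv g F a b = (1/2) * (F a b - \<i> * dual2 g F a b)"

definition weyl_tensor :: "real^4^4 \<Rightarrow> rtensor4 \<Rightarrow> bool" where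
  "weyl_tensor g C \<longleftrightarrow>
     (\<forall>a b c d. C a b c d = - C b a c d) \<and>
     (\<forall>a b c d. C a b c d = - C a b d c) \<and>
     (\<forall>a b c d. C a b c d = C c d a b) \<and>
     (\<forall>a b c d. C a b c d + C a c d b + C a d b c = 0) \<and>
     (\<forall>b d. (\<Sum>a\<in>UNIV. \<Sum>c\<in>UNIV. ginv g a c * C a b c d) = 0)"

definition petrov_eigenvalue :: "real^4^4 \<Rightarrow> rtensor4 \<Rightarrow> complex \<Rightarrow> bool" where
  "petrov_eigenvalue g C l \<longleftrightarrow> (\<exists>X :: cbivector.
     (\<forall>a b. X a b = - X b a) \<and> (\<exists>a b. X a b \<noteq> 0) \<and>
     (\<forall>a b. dual2 g X a b = \<i> * X a b) \<and>
     (\<forall>a b. (1/2) * (\<Sum>c\<in>UNIV. \<Sum>d\<in>UNIV. \<Sum>p\<in>UNIV. \<Sum>q\<in>UNIV.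
              complex_of_real (C a b c d * ginv g c p * ginv g d q) * X p q) = l * X a b))"

definition petrov_type_I :: "real^4^4 \<Rightarrow> rtensor4 \<Rightarrow> bool" where
  "petrov_type_I g C \<longleftrightarrow> (\<exists>l1 l2 l3. l1 \<noteq> l2 \<and> l1 \<noteq> l3 \<and> l2 \<noteq> l3 \<and>
     petrov_eigenvalue g C l1 \<and> petrov_eigenvalue g C l2 \<and> petrov_eigenvalue g C l3)"

definition bel_robinson :: "real^4^4 \<Rightarrow> rtensor4 \<Rightarrow> ctensor4" where
  "bel_robinson g C a b c d = (\<Sum>r\<in>UNIV. \<Sum>s\<in>UNIV. \<Sum>p\<in>UNIV. \<Sum>q\<in>UNIV.
      complex_of_real (ginv g r p * ginv g s q) * sd_weyl g C r a b s * cnj (sd_weyl g C p c d q))"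

text \<open>The quartic form t |-> T_abcd t^a t^b t^c t^d (T is real; we take the real part).\<close>
definition br_quartic :: "real^4^4 \<Rightarrow> rtensor4 \<Rightarrow> real^4 \<Rightarrow> real" where
  "br_quartic g C t = Re (\<Sum>a\<in>UNIV. \<Sum>b\<in>UNIV. \<Sum>c\<in>UNIV. \<Sum>d\<in>UNIV.
      bel_robinson g C a b c d * complex_of_real (t$a * t$b * t$c * t$d))"

definition wedge :: "(idx \<Rightarrow> real) \<Rightarrow> (idx \<Rightarrow> real) \<Rightarrow> cbivector" where
  "wedge p q a b = complex_of_real (p a * q b - p b * q a)"

definition canonical_petrov_tetrad ::
  "real^4^4 \<Rightarrow> real^4 \<Rightarrow> rtensor4 \<Rightarrow> real^4 \<Rightarrow> real^4 \<Rightarrow> real^4 \<Rightarrow> real^4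
     \<Rightarrow> complex \<Rightarrow> complex \<Rightarrow> complex \<Rightarrow> bool" where
  "canonical_petrov_tetrad g tau C v x y z s1 s2 s3 \<longleftrightarrow>
     gdot g v v = 1 \<and> gdot g x x = -1 \<and> gdot g y y = -1 \<and> gdot g z z = -1 \<and>
     gdot g v x = 0 \<and> gdot g v y = 0 \<and> gdot g v z = 0 \<and>
     gdot g x y = 0 \<and> gdot g x z = 0 \<and> gdot g y z = 0 \<and>
     gdot g v tau > 0 \<and> s1 + s2 + s3 = 0 \<and>
     (let F = sd_biv g (wedge (lower g v) (lower g x));
          G = sd_biv g (wedge (lower g v) (lower g y));
          H = sd_biv g (wedge (lower g v) (lower g z))
      in \<forall>a b c d. sd_weyl g C a b c d = s1 * F a b * F c d + s2 * G a b * G c d + s3 * H a b * H c d)"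

end

theory Submission
  imports Defs
begin

text \<open>
  In an orthonormal frame \<open>e\<close> with \<open>e 0 = u\<close> the self-dual Weyl tensor is
  \<open>\<Sum> q m n F\<^sub>m \<otimes> F\<^sub>n\<close>, where \<open>F\<^sub>m\<close> is the self-dual part of \<open>e 0 \<and> e m\<close> and \<open>q\<close> is a complex
  symmetric trace-free 3x3 matrix.  The spatial part of \<open>T(\<cdot>,u,u,u)\<close> is the dual of the
  imaginary part of \<open>q q\<^sup>*\<close>, i.e. of the commutator of \<open>Re q\<close> and \<open>Im q\<close>; if it vanishes, these two
  symmetric matrices have a common orthonormal eigenbasis, which is the canonical tetrad.

  If \<open>q = diag(s\<^sub>1, s\<^sub>2, s\<^sub>3)\<close>, put \<open>d\<^sub>1 = s\<^sub>2 - s\<^sub>3\<close> and cyclically.  For a unit vector \<open>t\<close>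
  the difference \<open>16 (T(t,t,t,t) - T(u,u,u,u))\<close> is a Hermitian form in \<open>(d\<^sub>1, d\<^sub>2)\<close>; its determinant is
  positive as soon as \<open>t\<close> has two nonzero spatial components, and with a single one it is a
  positive multiple of some \<open>|d\<^sub>i|\<^sup>2\<close>.  For type I the \<open>s\<^sub>i\<close> are distinct, as the
  eigenvalues of the Weyl tensor are \<open>-s\<^sub>i/2\<close>, so the minimum at \<open>u\<close> is strict.
  Conversely a minimum is a critical point, and the first variation of the quartic
  in the direction \<open>e i\<close> is proportional to \<open>T(e i,u,u,u)\<close>.
\<close>

subsection \<open>Commuting symmetric matrices\<close>

text \<open>A maximiser of \<open>x \<bullet> f x\<close> on the compact unit sphere of
  \<open>S\<close> is an eigenvector. Working in an invariant subspace allows later use inside an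
  eigenspace of another map.\<close>

lemma self_adjoint_has_eigenvector:
  fixes f :: "'a::euclidean_space \<Rightarrow> 'a"
  assumes "linear f" and sub: "subspace S" and nontriv: "S \<noteq> {0}"
    and inv: "\<And>x. x \<in> S \<Longrightarrow> f x \<in> S"
    and adj: "\<And>x y. x \<in> S \<Longrightarrow> y \<in> S \<Longrightarrow> f x \<bullet> y = x \<bullet> f y"
  obtains x l where "x \<in> S" "norm x = 1" "f x = l *\<^sub>R x"
proof -
  interpret linear f by fact
  let ?K = "S \<inter> sphere 0 1"
  have "closed S" using sub by (rule closed_subspace)
  moreover have "compact (sphere (0::'a) 1)"
    using compact_frontier[of "cball (0::'a) 1"] by (simp add: frontier_cball)
  ultimately have "compact ?K"
    by (simp add: closed_Int_compact)
  obtain y where "y \<in> S" "y \<noteq> 0"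
    using nontriv sub subspace_0 by fastforce
  then have "(1 / norm y) *\<^sub>R y \<in> ?K"
    using sub by (simp add: subspace_scale)
  then have "?K \<noteq> {}" by blast
  have "continuous_on ?K (\<lambda>x. x \<bullet> f x)"
    using \<open>linear f\<close> by (intro continuous_intros linear_continuous_on linear_conv_bounded_linear[THEN iffD1])
  then obtain x where x: "x \<in> ?K" and max: "\<And>y. y \<in> ?K \<Longrightarrow> y \<bullet> f y \<le> x \<bullet> f x"
    using continuous_attains_sup[OF \<open>compact ?K\<close> \<open>?K \<noteq> {}\<close>] by blast
  define l where "l = x \<bullet> f x"
  have xx: "x \<bullet> x = 1" and "x \<in> S" using x by (auto simp: norm_eq_1)
  have bound: "y \<bullet> f y \<le> l * (y \<bullet> y)" if "y \<in> S" for y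
  proof (cases "y = 0")
    case False
    then have "(1 / norm y) *\<^sub>R y \<in> ?K" using that sub by (simp add: subspace_scale)
    from max[OF this] have "(y \<bullet> f y) / (norm y)\<^sup>2 \<le> l"
      by (simp add: scale l_def power2_eq_square)
    then show ?thesis using False by (simp add: divide_le_eq power2_norm_eq_inner)
  qed (simp add: zero)
  \<comment> \<open>The residual \<open>w\<close> lies in \<open>S\<close> and is orthogonal to
    \<open>x\<close>. Maximality along \<open>x + r *\<^sub>R w\<close> will force it to
    vanish.\<close>
  define w where "w = f x - l *\<^sub>R x"
  have "w \<in> S" unfolding w_def using inv \<open>x \<in> S\<close> sub by (simp add: subspace_diff subspace_scale)
  have wx: "w \<bullet> x = 0"
    using inner_commute[of "f x" x] by (simp add: w_def inner_diff_left xx l_def)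
  have "f x = w + l *\<^sub>R x" by (simp add: w_def)
  then have wfx: "w \<bullet> f x = w \<bullet> w" by (simp add: inner_add_right wx)
  define b where "b = l * (w \<bullet> w) - w \<bullet> f w"
  have ineq: "2 * r * (w \<bullet> w) \<le> r\<^sup>2 * b" for r
  proof -
    have "x + r *\<^sub>R w \<in> S" using sub \<open>x \<in> S\<close> \<open>w \<in> S\<close> by (simp add: subspace_add subspace_scale)
    then have "(x + r *\<^sub>R w) \<bullet> f (x + r *\<^sub>R w) \<le> l * ((x + r *\<^sub>R w) \<bullet> (x + r *\<^sub>R w))"
      by (rule bound)
    moreover have "x \<bullet> f w = w \<bullet> w"
      using adj[OF \<open>w \<in> S\<close> \<open>x \<in> S\<close>] wfx by (simp add: inner_commute)
    ultimately show ?thesis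
      by (simp add: add scale inner_add_left inner_add_right wx wfx xx inner_commute[of x w]
          b_def power2_eq_square algebra_simps flip: l_def)
  qed
  have "w = 0"
  proof (rule ccontr)
    assume "w \<noteq> 0"
    then have pos: "w \<bullet> w > 0" by simp
    have "2 * (w \<bullet> w) \<le> b" using ineq[of 1] by simp
    then have "b > 0" using pos by linarith
    \<comment> \<open>The choice \<open>r = (w \<bullet> w) / b\<close> turns the quadratic bound
      into 2m \<le> m for a positive number m.\<close>
    have "2 * ((w \<bullet> w) / b) * (w \<bullet> w) \<le> ((w \<bullet> w) / b)\<^sup>2 * b" by (rule ineq)
    also have "\<dots> = ((w \<bullet> w) / b) * (w \<bullet> w)" using \<open>b > 0\<close> by (simp add: power2_eq_square)
    finally have "2 * ((w \<bullet> w) / b * (w \<bullet> w)) \<le> (w \<bullet> w) / b * (w \<bullet> w)" by simp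
    moreover have "(w \<bullet> w) / b * (w \<bullet> w) > 0"
      using pos \<open>b > 0\<close> by (intro mult_pos_pos divide_pos_pos)
    ultimately show False by linarith
  qed
  then show ?thesis using that[of x l] \<open>x \<in> S\<close> x by (simp add: w_def)
qed

text \<open>Since the maps commute, \<open>h\<close> preserves each eigenspace of \<open>f\<close>;
  an eigenvector of \<open>h\<close> found inside such an eigenspace is a common one.\<close>

lemma commuting_self_adjoint_common_eigenvector:
  fixes f h :: "'a::euclidean_space \<Rightarrow> 'a"
  assumes "linear f" "linear h" and sub: "subspace S" and "S \<noteq> {0}"
    and inv: "\<And>x. x \<in> S \<Longrightarrow> f x \<in> S" "\<And>x. x \<in> S \<Longrightarrow> h x \<in> S"
    and adj: "\<And>x y. f x \<bullet> y = x \<bullet> f y" "\<And>x y. h x \<bullet> y = x \<bullet> h y"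
    and comm: "\<And>x. f (h x) = h (f x)"
  obtains x k l where "x \<in> S" "norm x = 1" "f x = k *\<^sub>R x" "h x = l *\<^sub>R x"
proof -
  obtain x0 k where x0: "x0 \<in> S" "norm x0 = 1" "f x0 = k *\<^sub>R x0"
    using self_adjoint_has_eigenvector[OF \<open>linear f\<close> sub \<open>S \<noteq> {0}\<close> inv(1) adj(1)] by metis
  let ?S = "{x \<in> S. f x = k *\<^sub>R x}"
  have "subspace ?S"
    using sub \<open>linear f\<close>
    by (auto simp: subspace_def linear_0 linear_add linear_scale algebra_simps)
  moreover have "x0 \<in> ?S" "x0 \<noteq> 0" using x0 by auto
  then have "?S \<noteq> {0}" by blast
  moreover have "h x \<in> ?S" if "x \<in> ?S" for x
    using that inv(2) \<open>linear h\<close> by (simp add: comm linear_scale)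
  ultimately obtain x l where "x \<in> ?S" "norm x = 1" "h x = l *\<^sub>R x"
    using self_adjoint_has_eigenvector[OF \<open>linear h\<close> _ _ _ adj(2), of ?S] by metis
  then show ?thesis using that by blast
qed

lemma commuting_symmetric_matrices_diagonalization:
  fixes A B :: "real^3^3"
  assumes sym: "transpose A = A" "transpose B = B" and comm: "A ** B = B ** A"
  obtains b :: "3 \<Rightarrow> real^3" and k l :: "3 \<Rightarrow> real" where
    "\<And>i j. b i \<bullet> b j = (if i = j then 1 else 0)"
    "\<And>m n. A $ m $ n = (\<Sum>i\<in>UNIV. k i * b i $ m * b i $ n)"
    "\<And>m n. B $ m $ n = (\<Sum>i\<in>UNIV. l i * b i $ m * b i $ n)"
proof -
  let ?f = "(*v) A" and ?h = "(*v) B"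
  have lin: "linear ?f" "linear ?h" by simp_all
  have adj: "(A *v x) \<bullet> y = x \<bullet> (A *v y)" "(B *v x) \<bullet> y = x \<bullet> (B *v y)" for x y
    by (metis sym dot_lmul_matrix transpose_matrix_vector)+
  have cm: "A *v (B *v x) = B *v (A *v x)" for x
    by (simp add: matrix_vector_mul_assoc comm)
  note eig = commuting_self_adjoint_common_eigenvector[OF lin _ _ _ _ adj cm]
  \<comment> \<open>By self-adjointness, the orthogonal complement of a set of common eigenvectors
    is invariant under both matrices.\<close>
  have orth_inv: "\<forall>v\<in>V. (A *v x) \<bullet> v = 0 \<and> (B *v x) \<bullet> v = 0"
    if "\<forall>v\<in>V. x \<bullet> v = 0" "\<forall>v\<in>V. \<exists>k l. A *v v = k *\<^sub>R v \<and> B *v v = l *\<^sub>R v" for V x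
    using that by (metis adj inner_scaleR_right mult_zero_right)
  obtain b1 k1 l1 where b1: "norm b1 = 1" "A *v b1 = k1 *\<^sub>R b1" "B *v b1 = l1 *\<^sub>R b1"
  proof -
    have "(axis 1 1 :: real^3) \<noteq> 0" by (simp add: axis_eq_0_iff)
    then have "(UNIV :: (real^3) set) \<noteq> {0}" by blast
    then show ?thesis using eig[of UNIV] that by auto
  qed
  \<comment> \<open>Fewer than three vectors do not span the space, so their complement is nonzero
    and supplies a further common eigenvector.\<close>
  have step: "\<exists>b k l. (\<forall>v\<in>V. b \<bullet> v = 0) \<and> norm b = 1 \<and> A *v b = k *\<^sub>R b \<and> B *v b = l *\<^sub>R b"
    if V: "\<forall>v\<in>V. \<exists>k l. A *v v = k *\<^sub>R v \<and> B *v v = l *\<^sub>R v" "finite V" "card V < 3" for V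
  proof -
    let ?S = "{x. \<forall>v\<in>V. x \<bullet> v = 0}"
    have "subspace ?S" by (auto simp: subspace_def inner_add_left)
    have "dim V < DIM(real^3)" using dim_le_card'[OF \<open>finite V\<close>] V(3) by simp
    then obtain x where "x \<noteq> 0" "\<And>y. y \<in> span V \<Longrightarrow> orthogonal x y"
      using orthogonal_to_subspace_exists[of V] by blast
    then have "x \<in> ?S" by (simp add: orthogonal_def span_base)
    then have "?S \<noteq> {0}" using \<open>x \<noteq> 0\<close> by blast
    then obtain b k l where "b \<in> ?S" "norm b = 1" "A *v b = k *\<^sub>R b" "B *v b = l *\<^sub>R b"
      using eig[OF \<open>subspace ?S\<close>] orth_inv[OF _ V(1)] by (smt (verit) mem_Collect_eq)
    then show ?thesis by blast
  qed
  obtain b2 k2 l2 where b2: "b2 \<bullet> b1 = 0" "norm b2 = 1" "A *v b2 = k2 *\<^sub>R b2" "B *v b2 = l2 *\<^sub>R b2"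
    using step[of "{b1}"] b1 by auto
  have "card {b1, b2} < 3" by (simp add: card_insert_if)
  then obtain b3 k3 l3 where b3: "b3 \<bullet> b1 = 0" "b3 \<bullet> b2 = 0" "norm b3 = 1"
    "A *v b3 = k3 *\<^sub>R b3" "B *v b3 = l3 *\<^sub>R b3"
    using step[of "{b1, b2}"] b1 b2 by auto
  define b :: "3 \<Rightarrow> real^3" where "b i = (if i = 1 then b1 else if i = 2 then b2 else b3)" for i
  define k :: "3 \<Rightarrow> real" where "k i = (if i = 1 then k1 else if i = 2 then k2 else k3)" for i
  define l :: "3 \<Rightarrow> real" where "l i = (if i = 1 then l1 else if i = 2 then l2 else l3)" for i
  have "\<forall>i j. b i \<bullet> b j = (if i = j then 1 else 0)"
    unfolding forall_3 using b1(1) b2(1,2) b3(1-3) by (simp add: b_def inner_commute norm_eq_1)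
  then have orth: "b i \<bullet> b j = (if i = j then 1 else 0)" for i j by blast
  let ?U = "(\<chi> i. b i) :: real^3^3"
  have "?U ** transpose ?U = mat 1"
    using orth by (simp add: vec_eq_iff matrix_matrix_mult_def transpose_def mat_def inner_vec_def)
  then have U: "transpose ?U ** ?U = mat 1" using matrix_left_right_inverse by blast
  have expand: "M $ m $ n = (\<Sum>i\<in>UNIV. c i * b i $ m * b i $ n)"
    if "\<And>i. M *v b i = c i *\<^sub>R b i" for M :: "real^3^3" and c m n
  proof -
    \<comment> \<open>The rows of \<open>?U\<close> are the \<open>b i\<close>, so the columns of
      \<open>M ** transpose ?U\<close> are the images \<open>M *v b i\<close>.\<close>
    have "M = (M ** transpose ?U) ** ?U" by (simp add: matrix_mul_assoc[symmetric] U)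
    then have "M $ m $ n = ((M ** transpose ?U) ** ?U) $ m $ n" by simp
    also have "\<dots> = (\<Sum>i\<in>UNIV. (M *v b i) $ m * b i $ n)"
      by (simp add: matrix_matrix_mult_def transpose_def matrix_vector_mult_def)
    finally show ?thesis by (simp add: that)
  qed
  have "A *v b i = k i *\<^sub>R b i" "B *v b i = l i *\<^sub>R b i" for i
    using b1 b2 b3 by (simp_all add: b_def k_def l_def)
  then show ?thesis using that[of b k l] orth expand by blast
qed

subsection \<open>Oriented orthonormal frames\<close>

lemma UNIV_idx: "(UNIV :: 4 set) = {0, 1, 2, 3}"
proof -
  have "card {0, 1, 2, 3 :: 4} = CARD(4)" by simp
  then show ?thesis by (metis card_subset_eq finite subset_UNIV)
qed

lemma sum_idx: "sum f (UNIV :: 4 set) = f 0 + f 1 + f 2 + f 3"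
  for f :: "4 \<Rightarrow> 'a::comm_monoid_add"
  unfolding UNIV_idx by (simp add: ac_simps)

lemma all_idx: "(\<forall>i::4. P i) \<longleftrightarrow> P 0 \<and> P 1 \<and> P 2 \<and> P 3"
  by (metis UNIV_I UNIV_idx empty_iff insert_iff)

text \<open>Makes determinants, and with them the Levi-Civita symbol, computable by rewriting. The
  permutations are generated by inserting one index at a time.\<close>

lemma det_idx:
  "det (A::'a::comm_ring_1^4^4) =
    A$0$0*(A$1$1*(A$2$2*A$3$3-A$2$3*A$3$2)-A$1$2*(A$2$1*A$3$3-A$2$3*A$3$1)+A$1$3*(A$2$1*A$3$2-A$2$2*A$3$1))
   -A$0$1*(A$1$0*(A$2$2*A$3$3-A$2$3*A$3$2)-A$1$2*(A$2$0*A$3$3-A$2$3*A$3$0)+A$1$3*(A$2$0*A$3$2-A$2$2*A$3$0))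
   +A$0$2*(A$1$0*(A$2$1*A$3$3-A$2$3*A$3$1)-A$1$1*(A$2$0*A$3$3-A$2$3*A$3$0)+A$1$3*(A$2$0*A$3$1-A$2$1*A$3$0))
   -A$0$3*(A$1$0*(A$2$1*A$3$2-A$2$2*A$3$1)-A$1$1*(A$2$0*A$3$2-A$2$2*A$3$0)+A$1$2*(A$2$0*A$3$1-A$2$1*A$3$0))"
proof -
  have f: "finite {1, 2, 3::4}" "0 \<notin> {1, 2, 3::4}" "finite {2, 3::4}" "1 \<notin> {2, 3::4}"
    "finite {3::4}" "2 \<notin> {3::4}"
    by simp_all
  show ?thesis
    unfolding det_def UNIV_idx
    unfolding sum_over_permutations_insert[OF f(1,2)]
    unfolding sum_over_permutations_insert[OF f(3,4)]
    unfolding sum_over_permutations_insert[OF f(5,6)]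
    unfolding permutes_sing
    by (simp add: sign_swap_id permutation_swap_id sign_compose permutation_compose
        transpose_eq_iff Transposition.transpose_def algebra_simps)
qed

definition rows4 :: "real^4 \<Rightarrow> real^4 \<Rightarrow> real^4 \<Rightarrow> real^4 \<Rightarrow> real^4^4" where
  "rows4 p q r s = (\<chi> i. if i = 0 then p else if i = 1 then q else if i = 2 then r else s)"

lemma levi_civita_rows4: "levi_civita a b c d = det (rows4 (axis a 1) (axis b 1) (axis c 1) (axis d 1))"
  by (simp add: levi_civita_def rows4_def)

lemma levi_civita_eq_0:
  "levi_civita a a c d = 0" "levi_civita a b a d = 0" "levi_civita a b c a = 0"
  "levi_civita a b b d = 0" "levi_civita a b c b = 0" "levi_civita a b c c = 0"
  unfolding levi_civita_def
  by (rule det_identical_rows[of 0 1] det_identical_rows[of 0 2] det_identical_rows[of 0 3]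
      det_identical_rows[of 1 2] det_identical_rows[of 1 3] det_identical_rows[of 2 3],
      simp, simp add: row_def vec_eq_iff)+

lemma levi_civita_perm:
  "levi_civita 0 1 2 3 = 1" "levi_civita 0 1 3 2 = - 1" "levi_civita 0 2 1 3 = - 1"
  "levi_civita 0 2 3 1 = 1" "levi_civita 0 3 1 2 = 1" "levi_civita 0 3 2 1 = - 1"
  "levi_civita 1 0 2 3 = - 1" "levi_civita 1 0 3 2 = 1" "levi_civita 1 2 0 3 = 1"
  "levi_civita 1 2 3 0 = - 1" "levi_civita 1 3 0 2 = - 1" "levi_civita 1 3 2 0 = 1"
  "levi_civita 2 0 1 3 = 1" "levi_civita 2 0 3 1 = - 1" "levi_civita 2 1 0 3 = - 1"
  "levi_civita 2 1 3 0 = 1" "levi_civita 2 3 0 1 = 1" "levi_civita 2 3 1 0 = - 1"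
  "levi_civita 3 0 1 2 = - 1" "levi_civita 3 0 2 1 = 1" "levi_civita 3 1 0 2 = 1"
  "levi_civita 3 1 2 0 = - 1" "levi_civita 3 2 0 1 = - 1" "levi_civita 3 2 1 0 = 1"
  unfolding levi_civita_def det_idx by (simp_all add: axis_def)

lemma sum_levi_civita:
  "(\<Sum>a\<in>UNIV. \<Sum>b\<in>UNIV. \<Sum>c\<in>UNIV. \<Sum>d\<in>UNIV. levi_civita a b c d * (p$a * q$b * r$c * s$d))
    = det (rows4 p q r s)"
  unfolding sum_idx by (simp add: levi_civita_eq_0 levi_civita_perm rows4_def det_idx algebra_simps)

lemma orthonormal_gram:
  assumes "\<And>i j. gdot g (e i) (e j) = mink i j"
  shows "(\<chi> i. e i) ** g ** transpose (\<chi> i. e i) = (\<chi> i j. mink i j)"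
proof -
  have "((\<chi> i. e i) ** g ** transpose (\<chi> i. e i)) $ i $ j = gdot g (e i) (e j)" for i j
    unfolding gdot_def matrix_matrix_mult_def transpose_def
    by (simp add: sum_distrib_left sum_distrib_right mult_ac) (rule sum.swap)
  then show ?thesis by (simp add: vec_eq_iff assms)
qed

text \<open>Take determinants in the Gram identity; the Minkowski matrix has determinant -1.\<close>

lemma orthonormal_det:
  assumes "\<And>i j. gdot g (e i) (e j) = mink i j"
  shows "det g * (det (\<chi> i. e i))\<^sup>2 = -1"
proof -
  have "det ((\<chi> i. e i) ** g ** transpose (\<chi> i. e i)) = -1"
    unfolding orthonormal_gram[of g e, OF assms] by (simp add: det_idx mink_def)
  then show ?thesis
    by (simp add: det_mul power2_eq_square mult_ac)
qed

text \<open>Positive orientation fixes the sign in \<open>sqrt_det\<close>, so that the frame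
  components of the volume form are exactly \<open>levi_civita\<close>, not merely up to
  sign.\<close>

locale orthonormal_frame =
  fixes g :: "real^4^4" and e :: "idx \<Rightarrow> real^4"
  assumes metric_sym: "g$a$b = g$b$a"
    and orthonormal: "gdot g (e i) (e j) = mink i j"
    and oriented: "det (\<chi> i. e i) > 0"
begin

abbreviation frame :: "real^4^4" where "frame \<equiv> \<chi> i. e i"
abbreviation eta :: "real^4^4" where "eta \<equiv> \<chi> i j. mink i j"

lemma eta_eta: "eta ** eta = mat 1"
  unfolding vec_eq_iff matrix_matrix_mult_def mat_def all_idx
  by (simp add: sum_idx mink_def)

lemma frame_inverse: "transpose frame ** (eta ** frame ** g) = mat 1"
proof -
  have "(eta ** frame ** g) ** transpose frame = mat 1"
    using orthonormal_gram[of g e, OF orthonormal] eta_eta by (simp add: matrix_mul_assoc[symmetric])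
  then show ?thesis using matrix_left_right_inverse by blast
qed

lemma ginv_frame: "ginv g a b = (\<Sum>i\<in>UNIV. mink i i * e i $ a * e i $ b)"
proof -
  let ?N = "transpose frame ** eta ** frame"
  have N: "?N ** g = mat 1"
    using frame_inverse by (simp add: matrix_mul_assoc)
  then have "g ** ?N = mat 1" using matrix_left_right_inverse by blast
  \<comment> \<open>\<open>matrix_inv\<close> is defined by choice, so its inverse property is
    derived from the witness \<open>?N\<close>.\<close>
  then have inv: "g ** matrix_inv g = mat 1"
    using N someI[of "\<lambda>A. g ** A = mat 1 \<and> A ** g = mat 1" ?N]
    unfolding matrix_inv_def by blast
  have "matrix_inv g = (?N ** g) ** matrix_inv g" unfolding N by simp
  also have "\<dots> = ?N"
    unfolding matrix_mul_assoc[symmetric, of ?N] inv by simp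
  finally have "matrix_inv g = ?N" .
  moreover have "?N $ a $ b = (\<Sum>i\<in>UNIV. mink i i * e i $ a * e i $ b)"
    unfolding matrix_matrix_mult_def transpose_def
    by (simp add: sum_idx mink_def)
  ultimately show ?thesis by (simp add: ginv_def)
qed

lemma vector_frame: "t = (\<Sum>i\<in>UNIV. (mink i i * gdot g t (e i)) *\<^sub>R e i)"
proof -
  have "t = (transpose frame ** (eta ** frame ** g)) *v t"
    unfolding frame_inverse by simp
  also have "\<dots> = transpose frame *v (eta *v (frame *v (g *v t)))"
    by (simp add: matrix_vector_mul_assoc matrix_mul_assoc)
  also have "\<dots> = (\<Sum>i\<in>UNIV. (mink i i * gdot g t (e i)) *\<^sub>R e i)"
    unfolding vec_eq_iff matrix_vector_mult_def transpose_def gdot_def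
    by (simp add: sum_idx mink_def metric_sym algebra_simps)
  finally show ?thesis .
qed

lemma sqrt_det: "sqrt \<bar>det g\<bar> * det frame = 1"
proof -
  have "det g * (det frame)\<^sup>2 = -1"
    using orthonormal by (rule orthonormal_det)
  then have "\<bar>det g\<bar> * (det frame)\<^sup>2 = 1"
    by (metis abs_mult abs_minus_cancel abs_one abs_power2)
  then have "sqrt (\<bar>det g\<bar> * (det frame)\<^sup>2) = 1" by simp
  then show ?thesis using oriented by (simp add: real_sqrt_mult)
qed

text \<open>The matrix of four frame vectors is a matrix of unit rows times \<open>frame\<close>.
  Its determinant is the symbol times \<open>det frame\<close>, and the latter cancels against the
  density \<open>sqrt \<bar>det g\<bar>\<close>.\<close>

lemma vol_frame:
  "(\<Sum>a\<in>UNIV. \<Sum>b\<in>UNIV. \<Sum>c\<in>UNIV. \<Sum>d\<in>UNIV. vol g a b c d * (e i$a * e j$b * e k$c * e l$d))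
    = levi_civita i j k l"
proof -
  have axis: "(\<Sum>k\<in>UNIV. axis m 1 $ k * e k $ n) = e m $ n" for m n
    by (simp add: axis_def if_distrib[of "\<lambda>x. x * _"] cong: if_cong)
  have "rows4 (e i) (e j) (e k) (e l) = rows4 (axis i 1) (axis j 1) (axis k 1) (axis l 1) ** frame"
    by (simp add: vec_eq_iff matrix_matrix_mult_def rows4_def all_idx axis)
  then have "det (rows4 (e i) (e j) (e k) (e l)) = levi_civita i j k l * det frame"
    by (simp only: det_mul levi_civita_rows4)
  then have "sqrt \<bar>det g\<bar> * det (rows4 (e i) (e j) (e k) (e l))
      = levi_civita i j k l * (sqrt \<bar>det g\<bar> * det frame)"
    by (simp only: mult_ac)
  then have "sqrt \<bar>det g\<bar> * det (rows4 (e i) (e j) (e k) (e l)) = levi_civita i j k l"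
    by (simp only: sqrt_det mult_1_right)
  then show ?thesis
    unfolding vol_def sum_levi_civita[symmetric] by (simp only: sum_distrib_left mult.assoc)
qed

end

text \<open>Tensors of higher rank are evaluated by nesting \<open>ev\<close>, one slot at a time,
  which reduces multilinearity to the rules \<open>ev_linear\<close>.\<close>

definition ev :: "(idx \<Rightarrow> complex) \<Rightarrow> real^4 \<Rightarrow> complex" where
  "ev Y v = (\<Sum>a\<in>UNIV. Y a * complex_of_real (v$a))"

lemma ev_add: "ev (\<lambda>a. Y a + Z a) v = ev Y v + ev Z v"
  by (simp add: ev_def sum.distrib distrib_right)

lemma ev_diff: "ev (\<lambda>a. Y a - Z a) v = ev Y v - ev Z v"
  by (simp add: ev_def sum_subtractf left_diff_distrib)

lemma ev_minus: "ev (\<lambda>a. - Y a) v = - ev Y v"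
  by (simp add: ev_def sum_negf)

lemma ev_cmult: "ev (\<lambda>a. c * Y a) v = c * ev Y v"
  by (simp add: ev_def sum_distrib_left mult.assoc)

lemma ev_multc: "ev (\<lambda>a. Y a * c) v = ev Y v * c"
  by (simp add: ev_def sum_distrib_left sum_distrib_right mult_ac)

lemma ev_divide: "ev (\<lambda>a. Y a / c) v = ev Y v / c"
  by (simp add: ev_def sum_divide_distrib)

lemma ev_sum: "ev (\<lambda>a. \<Sum>i\<in>I. Y i a) v = (\<Sum>i\<in>I. ev (Y i) v)"
  unfolding ev_def sum_distrib_right by (rule sum.swap)

lemma ev_zero: "ev (\<lambda>a. 0) v = 0"
  by (simp add: ev_def)

lemma ev_cnj: "ev (\<lambda>a. cnj (Y a)) v = cnj (ev Y v)"
  by (simp add: ev_def)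

lemmas ev_linear = ev_add ev_diff ev_minus ev_cmult ev_multc ev_divide ev_sum ev_zero

lemma ev_swap: "ev (\<lambda>a. ev (X a) w) v = ev (\<lambda>b. ev (\<lambda>a. X a b) v) w"
proof -
  have "ev (\<lambda>b. ev (\<lambda>a. X a b) v) w
      = (\<Sum>a\<in>UNIV. \<Sum>b\<in>UNIV. X a b * complex_of_real (v$a) * complex_of_real (w$b))"
    unfolding ev_def sum_distrib_right by (rule sum.swap)
  then show ?thesis unfolding ev_def sum_distrib_right by (simp add: mult_ac)
qed

lemma ev_vec_add: "ev Y (v + w) = ev Y v + ev Y w"
  by (simp add: ev_def sum.distrib distrib_left)

lemma ev_vec_scaleR: "ev Y (c *\<^sub>R v) = complex_of_real c * ev Y v"
  by (simp add: ev_def sum_distrib_left mult_ac)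

lemma ev_vec_sum: "ev Y (\<Sum>i\<in>I. v i) = (\<Sum>i\<in>I. ev Y (v i))"
proof (induction I rule: infinite_finite_induct)
  case (insert x F)
  then show ?case by (simp add: ev_vec_add)
qed (simp_all add: ev_def)

lemma ev_lower: "ev (\<lambda>a. complex_of_real (lower g v a)) w = complex_of_real (gdot g v w)"
  if "\<And>a b. g$a$b = g$b$a"
proof -
  have "(\<Sum>a\<in>UNIV. lower g v a * w$a) = gdot g v w"
    unfolding lower_def gdot_def sum_distrib_right
    by (subst sum.swap) (simp add: that mult_ac)
  then show ?thesis by (simp add: ev_def flip: of_real_mult of_real_sum)
qed

lemma sum_swap_pairs:
  "(\<Sum>p\<in>A. \<Sum>q\<in>B. \<Sum>r\<in>C. \<Sum>s\<in>D. f p q r s) = (\<Sum>r\<in>C. \<Sum>s\<in>D. \<Sum>p\<in>A. \<Sum>q\<in>B. f p q r s)"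
proof -
  have "(\<Sum>p\<in>A. \<Sum>q\<in>B. \<Sum>r\<in>C. \<Sum>s\<in>D. f p q r s) = (\<Sum>p\<in>A. \<Sum>r\<in>C. \<Sum>s\<in>D. \<Sum>q\<in>B. f p q r s)"
    by (intro sum.cong refl, subst sum.swap, intro sum.cong refl, subst sum.swap, rule refl)
  also have "\<dots> = (\<Sum>r\<in>C. \<Sum>p\<in>A. \<Sum>s\<in>D. \<Sum>q\<in>B. f p q r s)"
    by (rule sum.swap)
  also have "\<dots> = (\<Sum>r\<in>C. \<Sum>s\<in>D. \<Sum>p\<in>A. \<Sum>q\<in>B. f p q r s)"
    by (intro sum.cong refl, rule sum.swap)
  finally show ?thesis .
qed

section \<open>Frame components and contraction with the inverse metric\<close>

context orthonormal_frame
begin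

definition comp2 :: "cbivector \<Rightarrow> idx \<Rightarrow> idx \<Rightarrow> complex" where
  "comp2 X i j = ev (\<lambda>a. ev (X a) (e j)) (e i)"

lemma ev_eqI:
  assumes "\<And>i. ev Y (e i) = ev Z (e i)"
  shows "Y = Z"
proof
  fix a
  have "ev Y v = ev Z v" for v
    by (subst (1 2) vector_frame) (simp add: ev_vec_sum ev_vec_scaleR assms)
  from this[of "axis a 1"] show "Y a = Z a"
    by (simp add: ev_def axis_def if_distrib[of "\<lambda>x. _ * complex_of_real x"] cong: if_cong)
qed

lemma comp2_eqI:
  assumes "\<And>i j. comp2 X i j = comp2 Y i j"
  shows "X = Y"
proof
  fix a
  have "(\<lambda>a. ev (X a) (e j)) = (\<lambda>a. ev (Y a) (e j))" for j
    by (rule ev_eqI) (use assms in \<open>simp add: comp2_def\<close>)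
  then show "X a = Y a"
    by (intro ev_eqI) meson
qed

lemma ginv_trace:
  "(\<Sum>r\<in>UNIV. \<Sum>p\<in>UNIV. complex_of_real (ginv g r p) * X r p)
    = (\<Sum>i\<in>UNIV. complex_of_real (mink i i) * comp2 X i i)"
proof -
  have "(\<Sum>i\<in>UNIV. complex_of_real (mink i i) * comp2 X i i)
    = (\<Sum>i\<in>UNIV. \<Sum>r\<in>UNIV. \<Sum>p\<in>UNIV. complex_of_real (mink i i * e i $ r * e i $ p) * X r p)"
    unfolding comp2_def ev_def sum_distrib_left sum_distrib_right by (simp add: mult_ac)
  also have "\<dots> = (\<Sum>r\<in>UNIV. \<Sum>i\<in>UNIV. \<Sum>p\<in>UNIV. complex_of_real (mink i i * e i $ r * e i $ p) * X r p)"
    by (rule sum.swap)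
  also have "\<dots> = (\<Sum>r\<in>UNIV. \<Sum>p\<in>UNIV. \<Sum>i\<in>UNIV. complex_of_real (mink i i * e i $ r * e i $ p) * X r p)"
    by (rule sum.cong[OF refl], rule sum.swap)
  finally show ?thesis
    by (simp add: ginv_frame sum_distrib_right)
qed

lemma ginv_contract:
  "(\<Sum>r\<in>UNIV. \<Sum>p\<in>UNIV. complex_of_real (ginv g r p) * Y r * Z p)
    = (\<Sum>i\<in>UNIV. complex_of_real (mink i i) * ev Y (e i) * ev Z (e i))"
  using ginv_trace[of "\<lambda>r p. Y r * Z p"] by (simp add: comp2_def ev_linear mult.assoc)

text \<open>Follows by contracting one index pair at a time. It turns the contractions in the dual,
  in the Petrov eigenvalue equation and in the Bel-Robinson tensor into signed sums over frame
  components.\<close>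

lemma ginv_contract2:
  "(\<Sum>r\<in>UNIV. \<Sum>s\<in>UNIV. \<Sum>p\<in>UNIV. \<Sum>q\<in>UNIV.
      complex_of_real (ginv g r p) * complex_of_real (ginv g s q) * Y r s * Z p q)
    = (\<Sum>i\<in>UNIV. \<Sum>j\<in>UNIV. complex_of_real (mink i i) * complex_of_real (mink j j) * comp2 Y i j * comp2 Z i j)"
proof -
  have "(\<Sum>r\<in>UNIV. \<Sum>s\<in>UNIV. \<Sum>p\<in>UNIV. \<Sum>q\<in>UNIV.
      complex_of_real (ginv g r p) * complex_of_real (ginv g s q) * Y r s * Z p q)
    = (\<Sum>r\<in>UNIV. \<Sum>p\<in>UNIV. complex_of_real (ginv g r p) *
        (\<Sum>s\<in>UNIV. \<Sum>q\<in>UNIV. complex_of_real (ginv g s q) * Y r s * Z p q))"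
    unfolding sum_distrib_left
    by (rule sum.cong[OF refl], subst sum.swap) (simp add: mult_ac)
  also have "\<dots> = (\<Sum>r\<in>UNIV. \<Sum>p\<in>UNIV. \<Sum>j\<in>UNIV. complex_of_real (mink j j) *
        (complex_of_real (ginv g r p) * ev (Y r) (e j) * ev (Z p) (e j)))"
    unfolding ginv_contract sum_distrib_left by (simp add: mult_ac)
  also have "\<dots> = (\<Sum>r\<in>UNIV. \<Sum>j\<in>UNIV. \<Sum>p\<in>UNIV. complex_of_real (mink j j) *
        (complex_of_real (ginv g r p) * ev (Y r) (e j) * ev (Z p) (e j)))"
    by (rule sum.cong[OF refl], rule sum.swap)
  also have "\<dots> = (\<Sum>j\<in>UNIV. \<Sum>r\<in>UNIV. \<Sum>p\<in>UNIV. complex_of_real (mink j j) *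
        (complex_of_real (ginv g r p) * ev (Y r) (e j) * ev (Z p) (e j)))"
    by (rule sum.swap)
  also have "\<dots> = (\<Sum>j\<in>UNIV. complex_of_real (mink j j) *
      (\<Sum>i\<in>UNIV. complex_of_real (mink i i) * comp2 Y i j * comp2 Z i j))"
    unfolding sum_distrib_left[symmetric] ginv_contract comp2_def ..
  also have "\<dots> = (\<Sum>i\<in>UNIV. \<Sum>j\<in>UNIV.
      complex_of_real (mink i i) * complex_of_real (mink j j) * comp2 Y i j * comp2 Z i j)"
    unfolding sum_distrib_left by (subst sum.swap) (simp add: mult_ac)
  finally show ?thesis .
qed

text \<open>Contracting the last pair of the volume form by \<open>ginv_contract2\<close> and
  evaluating the first pair on the frame leaves frame components in all four slots, which
  \<open>vol_frame\<close> computes.\<close>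

lemma comp2_dual2:
  "comp2 (dual2 g X) i j = (1/2) * (\<Sum>k\<in>UNIV. \<Sum>l\<in>UNIV.
     complex_of_real (mink k k) * complex_of_real (mink l l) * complex_of_real (levi_civita i j k l) * comp2 X k l)"
proof -
  have dual: "dual2 g X a b = (1/2) * (\<Sum>k\<in>UNIV. \<Sum>l\<in>UNIV.
     complex_of_real (mink k k) * complex_of_real (mink l l) *
       comp2 (\<lambda>r s. complex_of_real (vol g a b r s)) k l * comp2 X k l)" for a b
    unfolding dual2_def ginv_contract2[symmetric]
    by (subst sum_swap_pairs) (simp add: mult_ac)
  have vol: "comp2 (\<lambda>a b. comp2 (\<lambda>r s. complex_of_real (vol g a b r s)) k l) i j
      = complex_of_real (levi_civita i j k l)" for k l
    unfolding vol_frame[symmetric] comp2_def ev_def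
    by (simp add: sum_distrib_right sum_distrib_left mult_ac)
  have linear: "comp2 (\<lambda>a b. c * (\<Sum>k\<in>UNIV. \<Sum>l\<in>UNIV. m k l * V a b k l * x k l)) i j
      = c * (\<Sum>k\<in>UNIV. \<Sum>l\<in>UNIV. m k l * comp2 (\<lambda>a b. V a b k l) i j * x k l)"
    for c and m x :: "idx \<Rightarrow> idx \<Rightarrow> complex" and V
    by (simp only: comp2_def ev_linear)
  have "dual2 g X = (\<lambda>a b. (1/2) * (\<Sum>k\<in>UNIV. \<Sum>l\<in>UNIV.
     complex_of_real (mink k k) * complex_of_real (mink l l) *
       comp2 (\<lambda>r s. complex_of_real (vol g a b r s)) k l * comp2 X k l))"
    using dual by blast
  then show ?thesis by (simp only: linear vol)
qed

end

subsection \<open>Self-dual bivectors\<close>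

definition sd_wedge :: "real^4^4 \<Rightarrow> real^4 \<Rightarrow> real^4 \<Rightarrow> cbivector" where
  "sd_wedge g v x = sd_biv g (wedge (lower g v) (lower g x))"

lemma dual2_add: "dual2 g (\<lambda>a b. X a b + Y a b) a b = dual2 g X a b + dual2 g Y a b"
  by (simp add: dual2_def distrib_left sum.distrib)

lemma dual2_cmult: "dual2 g (\<lambda>a b. c * X a b) a b = c * dual2 g X a b"
  unfolding dual2_def sum_distrib_left by (simp add: mult_ac)

lemma sd_biv_add: "sd_biv g (\<lambda>a b. X a b + Y a b) a b = sd_biv g X a b + sd_biv g Y a b"
  by (simp add: sd_biv_def dual2_add field_simps)

lemma sd_biv_cmult: "sd_biv g (\<lambda>a b. c * X a b) a b = c * sd_biv g X a b"
  by (simp add: sd_biv_def dual2_cmult field_simps)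

lemma sd_biv_sum: "sd_biv g (\<lambda>a b. \<Sum>i\<in>I. X i a b) a b = (\<Sum>i\<in>I. sd_biv g (X i) a b)"
proof (induction I rule: infinite_finite_induct)
  case (insert i I)
  then show ?case by (simp add: sd_biv_add)
qed (simp_all add: sd_biv_def dual2_def)

lemma sd_wedge_add: "sd_wedge g v (x + y) a b = sd_wedge g v x a b + sd_wedge g v y a b"
proof -
  have "wedge (lower g v) (lower g (x + y))
      = (\<lambda>a b. wedge (lower g v) (lower g x) a b + wedge (lower g v) (lower g y) a b)"
    by (intro ext) (simp add: wedge_def lower_def sum.distrib algebra_simps)
  then show ?thesis by (simp add: sd_wedge_def sd_biv_add)
qed

lemma sd_wedge_scaleR: "sd_wedge g v (c *\<^sub>R x) a b = complex_of_real c * sd_wedge g v x a b"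
proof -
  have "lower g (c *\<^sub>R x) a = c * lower g x a" for a
    by (simp add: lower_def sum_distrib_left mult_ac)
  then have "wedge (lower g v) (lower g (c *\<^sub>R x))
      = (\<lambda>a b. complex_of_real c * wedge (lower g v) (lower g x) a b)"
    by (intro ext) (simp add: wedge_def algebra_simps)
  then show ?thesis by (simp add: sd_wedge_def sd_biv_cmult)
qed

context orthonormal_frame
begin

abbreviation biv :: "idx \<Rightarrow> cbivector" where
  "biv m \<equiv> sd_wedge g (e 0) (e m)"

lemma comp2_linear:
  "comp2 (\<lambda>a b. X a b + Y a b) i j = comp2 X i j + comp2 Y i j"
  "comp2 (\<lambda>a b. X a b - Y a b) i j = comp2 X i j - comp2 Y i j"
  "comp2 (\<lambda>a b. - X a b) i j = - comp2 X i j"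
  "comp2 (\<lambda>a b. c * X a b) i j = c * comp2 X i j"
  by (simp_all only: comp2_def ev_linear)

lemma comp2_sd_biv: "comp2 (sd_biv g X) i j = (1/2) * (comp2 X i j - \<i> * comp2 (dual2 g X) i j)"
proof -
  have "sd_biv g X = (\<lambda>a b. (1/2) * (X a b - \<i> * dual2 g X a b))"
    by (intro ext) (simp add: sd_biv_def)
  then show ?thesis by (simp only: comp2_linear)
qed

lemma comp2_antisym:
  assumes "\<And>a b. X a b = - X b a"
  shows "comp2 X i j = - comp2 X j i"
proof -
  have "comp2 X i j = ev (\<lambda>b. ev (\<lambda>a. X a b) (e i)) (e j)"
    unfolding comp2_def by (rule ev_swap)
  also have "(\<lambda>b. ev (\<lambda>a. X a b) (e i)) = (\<lambda>b. - ev (X b) (e i))"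
    by (subst assms) (simp add: ev_minus)
  finally show ?thesis by (simp add: comp2_def ev_minus)
qed

lemma comp2_wedge:
  "comp2 (wedge (lower g (e m)) (lower g (e n))) i j
    = complex_of_real (mink m i * mink n j - mink m j * mink n i)"
proof -
  have w: "wedge (lower g (e m)) (lower g (e n)) = (\<lambda>a b.
     complex_of_real (lower g (e m) a) * complex_of_real (lower g (e n) b)
      - complex_of_real (lower g (e m) b) * complex_of_real (lower g (e n) a))"
    by (intro ext) (simp add: wedge_def)
  show ?thesis
    unfolding w comp2_def by (simp add: ev_linear ev_lower[OF metric_sym] orthonormal)
qed

lemma comp2_biv:
  "comp2 (biv m) i j = (1/2) * (complex_of_real (mink 0 i * mink m j - mink 0 j * mink m i)
     - \<i> * complex_of_real (levi_civita i j 0 m))"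
proof -
  \<comment> \<open>This computes the dual of the wedge of \<open>e 0\<close> and
    \<open>e m\<close>. The signs from lowering the two vectors cancel those from raising the
    indices of the wedge.\<close>
  have "\<forall>m i j. (1/2) * (\<Sum>k\<in>UNIV. \<Sum>l\<in>UNIV. complex_of_real (mink k k) * complex_of_real (mink l l) *
       complex_of_real (levi_civita i j k l) * complex_of_real (mink 0 k * mink m l - mink 0 l * mink m k)) = complex_of_real (levi_civita i j 0 m)"
    unfolding all_idx sum_idx
    by (simp add: mink_def levi_civita_eq_0 levi_civita_perm)
  then show ?thesis
    by (simp add: sd_wedge_def comp2_sd_biv comp2_dual2 comp2_wedge)
qed

lemmas biv_table = comp2_biv mink_def levi_civita_eq_0 levi_civita_perm

lemma levi_civita_antisym: "levi_civita i j k l = - levi_civita j i k l"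
proof -
  have "\<forall>i j k l. levi_civita i j k l = - levi_civita j i k l"
    unfolding all_idx by (simp add: levi_civita_eq_0 levi_civita_perm)
  then show ?thesis by blast
qed

lemma comp2_dual2_antisym: "comp2 (dual2 g X) i j = - comp2 (dual2 g X) j i"
  unfolding comp2_dual2 by (subst levi_civita_antisym) (simp add: sum_negf)

text \<open>Self-duality reduces the six components of a bivector to the electric ones
  \<open>comp2 X 0 m\<close>. The factor -2 inverts
  \<open>comp2 (biv m) 0 m = - 1/2\<close>.\<close>

lemma self_dual_expansion:
  assumes antisym: "\<And>i j. comp2 X i j = - comp2 X j i"
    and self_dual: "comp2 X 2 3 = \<i> * comp2 X 0 1" "comp2 X 3 1 = \<i> * comp2 X 0 2"
      "comp2 X 1 2 = \<i> * comp2 X 0 3"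
  shows "X a b = - 2 * (comp2 X 0 1 * biv 1 a b + comp2 X 0 2 * biv 2 a b + comp2 X 0 3 * biv 3 a b)"
proof -
  have diag: "comp2 X i i = 0" for i
    using antisym[of i i] by (simp add: equal_neg_zero)
  have "\<forall>i j. comp2 X i j =
      comp2 (\<lambda>a b. - 2 * (comp2 X 0 1 * biv 1 a b + comp2 X 0 2 * biv 2 a b + comp2 X 0 3 * biv 3 a b)) i j"
    using self_dual antisym[of 1 0] antisym[of 2 0] antisym[of 3 0] antisym[of 1 3]
      antisym[of 3 2] antisym[of 2 1]
    unfolding all_idx comp2_linear
    by (simp add: diag biv_table)
  then have "X = (\<lambda>a b. - 2 * (comp2 X 0 1 * biv 1 a b + comp2 X 0 2 * biv 2 a b + comp2 X 0 3 * biv 3 a b))"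
    by (intro comp2_eqI) blast
  then show ?thesis by meson
qed

lemma comp2_dual2_table:
  assumes antisym: "\<And>i j. comp2 X i j = - comp2 X j i"
  shows "comp2 (dual2 g X) 0 1 = comp2 X 2 3" "comp2 (dual2 g X) 0 2 = comp2 X 3 1"
    "comp2 (dual2 g X) 0 3 = comp2 X 1 2" "comp2 (dual2 g X) 2 3 = - comp2 X 0 1"
    "comp2 (dual2 g X) 3 1 = - comp2 X 0 2" "comp2 (dual2 g X) 1 2 = - comp2 X 0 3"
  using antisym[of 1 0] antisym[of 2 0] antisym[of 3 0] antisym[of 1 3] antisym[of 3 2] antisym[of 2 1]
  unfolding comp2_dual2 sum_idx
  by (simp_all add: mink_def levi_civita_eq_0 levi_civita_perm)

text \<open>The dual squares to -1 on bivectors, so the self-dual part satisfies the hypotheses of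
  \<open>self_dual_expansion\<close>. Its electric components are half of
  \<open>comp2 X 0 m - \<i> * comp2 X j k\<close> with m, j, k cyclic.\<close>

lemma sd_biv_expansion:
  assumes "\<And>a b. X a b = - X b a"
  shows "sd_biv g X a b = - ((comp2 X 0 1 - \<i> * comp2 X 2 3) * biv 1 a b
    + (comp2 X 0 2 - \<i> * comp2 X 3 1) * biv 2 a b + (comp2 X 0 3 - \<i> * comp2 X 1 2) * biv 3 a b)"
proof -
  have X: "comp2 X i j = - comp2 X j i" for i j
    using assms by (rule comp2_antisym)
  note table = comp2_sd_biv comp2_dual2_table[OF X]
  have "comp2 (sd_biv g X) i j = - comp2 (sd_biv g X) j i" for i j
    unfolding comp2_sd_biv by (subst X, subst comp2_dual2_antisym) (simp add: algebra_simps)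
  then have "sd_biv g X a b = - 2 * (comp2 (sd_biv g X) 0 1 * biv 1 a b
      + comp2 (sd_biv g X) 0 2 * biv 2 a b + comp2 (sd_biv g X) 0 3 * biv 3 a b)"
    by (rule self_dual_expansion) (simp_all add: table algebra_simps)
  then show ?thesis by (simp add: table algebra_simps)
qed

end

subsection \<open>The self-dual Weyl tensor in a frame\<close>

context orthonormal_frame
begin

definition comp4 :: "rtensor4 \<Rightarrow> idx \<Rightarrow> idx \<Rightarrow> idx \<Rightarrow> idx \<Rightarrow> real" where
  "comp4 C i j k l = (\<Sum>a\<in>UNIV. \<Sum>b\<in>UNIV. \<Sum>c\<in>UNIV. \<Sum>d\<in>UNIV. C a b c d * (e i$a * e j$b * e k$c * e l$d))"

lemma comp2_comp2: "comp2 (\<lambda>a b. comp2 (\<lambda>c d. complex_of_real (C a b c d)) k l) i j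
    = complex_of_real (comp4 C i j k l)"
  unfolding comp4_def comp2_def ev_def by (simp add: sum_distrib_right sum_distrib_left mult_ac)

lemma comp4_pair:
  assumes "\<And>a b c d. C a b c d = C c d a b"
  shows "comp4 C i j k l = comp4 C k l i j"
proof -
  have "comp4 C i j k l = (\<Sum>c\<in>UNIV. \<Sum>d\<in>UNIV. \<Sum>a\<in>UNIV. \<Sum>b\<in>UNIV. C a b c d * (e i$a * e j$b * e k$c * e l$d))"
    unfolding comp4_def by (rule sum_swap_pairs)
  also have "\<dots> = comp4 C k l i j"
    unfolding comp4_def by (subst assms) (simp add: mult_ac)
  finally show ?thesis .
qed

lemma comp4_antisym1:
  assumes "\<And>a b c d. C a b c d = - C b a c d"
  shows "comp4 C i j k l = - comp4 C j i k l"
  unfolding comp4_def by (subst sum.swap, subst assms) (simp add: sum_negf mult_ac)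

lemma comp4_cyclic:
  assumes "\<And>a b c d. C a b c d + C a c d b + C a d b c = 0"
  shows "comp4 C i j k l + comp4 C i k l j + comp4 C i l j k = 0"
proof -
  have rot: "(\<Sum>b\<in>UNIV. \<Sum>c\<in>UNIV. \<Sum>d\<in>UNIV. f b c d) = (\<Sum>c\<in>UNIV. \<Sum>d\<in>UNIV. \<Sum>b\<in>UNIV. f b c d)"
    for f :: "idx \<Rightarrow> idx \<Rightarrow> idx \<Rightarrow> real"
    by (subst sum.swap, rule sum.cong[OF refl], rule sum.swap)
  have 1: "comp4 C i k l j = (\<Sum>a\<in>UNIV. \<Sum>b\<in>UNIV. \<Sum>c\<in>UNIV. \<Sum>d\<in>UNIV. C a c d b * (e i$a * e j$b * e k$c * e l$d))"
    unfolding comp4_def by (subst rot) (simp add: mult_ac)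
  have 2: "comp4 C i l j k = (\<Sum>a\<in>UNIV. \<Sum>b\<in>UNIV. \<Sum>c\<in>UNIV. \<Sum>d\<in>UNIV. C a d b c * (e i$a * e j$b * e k$c * e l$d))"
    unfolding comp4_def by (subst rot, subst rot) (simp add: mult_ac)
  show ?thesis unfolding 1 2
    unfolding comp4_def sum.distrib[symmetric] distrib_right[symmetric] assms by simp
qed

lemma comp4_trace:
  assumes "\<And>b d. (\<Sum>a\<in>UNIV. \<Sum>c\<in>UNIV. ginv g a c * C a b c d) = 0"
  shows "comp4 C 0 j 0 l - comp4 C 1 j 1 l - comp4 C 2 j 2 l - comp4 C 3 j 3 l = 0"
proof -
  \<comment> \<open>The two traced slots are moved innermost, where \<open>ginv_trace\<close> can
    act on them.\<close>
  have reorder: "complex_of_real (comp4 C i j i l)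
    = ev (\<lambda>b. ev (\<lambda>d. comp2 (\<lambda>a c. complex_of_real (C a b c d)) i i) (e l)) (e j)" for i
  proof -
    have "complex_of_real (comp4 C i j i l) =
        ev (\<lambda>b. ev (\<lambda>a. ev (\<lambda>c. ev (\<lambda>d. complex_of_real (C a b c d)) (e l)) (e i)) (e i)) (e j)"
      unfolding comp2_comp2[symmetric] comp2_def by (rule ev_swap)
    also have "\<dots> = ev (\<lambda>b. ev (\<lambda>a. ev (\<lambda>d. ev (\<lambda>c. complex_of_real (C a b c d)) (e i)) (e l)) (e i)) (e j)"
      by (subst (2) ev_swap) (rule refl)
    also have "\<dots> = ev (\<lambda>b. ev (\<lambda>d. ev (\<lambda>a. ev (\<lambda>c. complex_of_real (C a b c d)) (e i)) (e i)) (e l)) (e j)"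
      by (subst (3) ev_swap) (rule refl)
    finally show ?thesis unfolding comp2_def .
  qed
  have "(\<Sum>i\<in>UNIV. complex_of_real (mink i i) * comp2 (\<lambda>a c. complex_of_real (C a b c d)) i i) = 0" for b d
    unfolding ginv_trace[symmetric] of_real_mult[symmetric] of_real_sum[symmetric] assms by simp
  then have "(\<Sum>i\<in>UNIV. complex_of_real (mink i i) * complex_of_real (comp4 C i j i l)) = 0"
    unfolding reorder by (simp only: ev_linear[symmetric] ev_zero)
  then have "complex_of_real (comp4 C 0 j 0 l - comp4 C 1 j 1 l - comp4 C 2 j 2 l - comp4 C 3 j 3 l) = 0"
    unfolding sum_idx by (simp add: mink_def)
  then show ?thesis by (simp only: of_real_eq_0_iff)
qed

text \<open>The first eighteen equations say that the duals on the left and on the right index pair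
  agree. The last two say that the electric and magnetic parts are trace-free; the magnetic one is
  the cyclic identity.\<close>

lemma weyl_duality:
  assumes "weyl_tensor g C"
  shows "comp4 C 2 3 2 3 = - comp4 C 0 1 0 1" "comp4 C 2 3 3 1 = - comp4 C 0 1 0 2" "comp4 C 2 3 1 2 = - comp4 C 0 1 0 3"
    "comp4 C 3 1 2 3 = - comp4 C 0 2 0 1" "comp4 C 3 1 3 1 = - comp4 C 0 2 0 2" "comp4 C 3 1 1 2 = - comp4 C 0 2 0 3"
    "comp4 C 1 2 2 3 = - comp4 C 0 3 0 1" "comp4 C 1 2 3 1 = - comp4 C 0 3 0 2" "comp4 C 1 2 1 2 = - comp4 C 0 3 0 3"
    "comp4 C 0 1 2 3 = comp4 C 2 3 0 1" "comp4 C 0 1 3 1 = comp4 C 2 3 0 2" "comp4 C 0 1 1 2 = comp4 C 2 3 0 3"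
    "comp4 C 0 2 2 3 = comp4 C 3 1 0 1" "comp4 C 0 2 3 1 = comp4 C 3 1 0 2" "comp4 C 0 2 1 2 = comp4 C 3 1 0 3"
    "comp4 C 0 3 2 3 = comp4 C 1 2 0 1" "comp4 C 0 3 3 1 = comp4 C 1 2 0 2" "comp4 C 0 3 1 2 = comp4 C 1 2 0 3"
    "comp4 C 0 1 0 1 + comp4 C 0 2 0 2 + comp4 C 0 3 0 3 = 0"
    "comp4 C 2 3 0 1 + comp4 C 3 1 0 2 + comp4 C 1 2 0 3 = 0"
proof -
  have a1: "comp4 C i j k l = - comp4 C j i k l" for i j k l
    using assms unfolding weyl_tensor_def by (intro comp4_antisym1) blast
  have p: "comp4 C i j k l = comp4 C k l i j" for i j k l
    using assms unfolding weyl_tensor_def by (intro comp4_pair) blast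
  have a2: "comp4 C i j k l = - comp4 C i j l k" for i j k l
    by (metis a1 p)
  have cyc: "comp4 C i j k l + comp4 C i k l j + comp4 C i l j k = 0" for i j k l
    using assms unfolding weyl_tensor_def by (intro comp4_cyclic) blast
  have tr: "comp4 C 0 j 0 l - comp4 C 1 j 1 l - comp4 C 2 j 2 l - comp4 C 3 j 3 l = 0" for j l
    using assms unfolding weyl_tensor_def by (intro comp4_trace) blast
  have z1: "comp4 C i i k l = 0" for i k l using a1[of i i k l] by simp
  have z2: "comp4 C i j k k = 0" for i j k using a2[of i j k k] by simp
  \<comment> \<open>These rules sort the indices within each pair and then the two pairs. Afterwards
    the traces and the cyclic identity are linear relations from which all claims follow
    arithmetically.\<close>
  note normal = a1[of 1 0] a1[of 2 0] a1[of 3 0] a1[of 3 1] a1[of 3 2] a1[of 2 1]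
    a2[of _ _ 1 0] a2[of _ _ 2 0] a2[of _ _ 3 0] a2[of _ _ 3 1] a2[of _ _ 3 2] a2[of _ _ 2 1]
    p[of 0 2 0 1] p[of 0 3 0 1] p[of 1 2 0 1] p[of 1 3 0 1] p[of 2 3 0 1]
    p[of 0 3 0 2] p[of 1 2 0 2] p[of 1 3 0 2] p[of 2 3 0 2]
    p[of 1 2 0 3] p[of 1 3 0 3] p[of 2 3 0 3] p[of 1 3 1 2] p[of 2 3 1 2] p[of 2 3 1 3] z1 z2
  note traces = tr[of 0 0] tr[of 0 1] tr[of 0 2] tr[of 0 3] tr[of 1 1] tr[of 1 2] tr[of 1 3]
      tr[of 2 2] tr[of 2 3] tr[of 3 3] cyc[of 0 1 2 3]
  note rels = traces[simplified normal]
  show "comp4 C 2 3 2 3 = - comp4 C 0 1 0 1" "comp4 C 2 3 3 1 = - comp4 C 0 1 0 2" "comp4 C 2 3 1 2 = - comp4 C 0 1 0 3"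
    "comp4 C 3 1 2 3 = - comp4 C 0 2 0 1" "comp4 C 3 1 3 1 = - comp4 C 0 2 0 2" "comp4 C 3 1 1 2 = - comp4 C 0 2 0 3"
    "comp4 C 1 2 2 3 = - comp4 C 0 3 0 1" "comp4 C 1 2 3 1 = - comp4 C 0 3 0 2" "comp4 C 1 2 1 2 = - comp4 C 0 3 0 3"
    "comp4 C 0 1 2 3 = comp4 C 2 3 0 1" "comp4 C 0 1 3 1 = comp4 C 2 3 0 2" "comp4 C 0 1 1 2 = comp4 C 2 3 0 3"
    "comp4 C 0 2 2 3 = comp4 C 3 1 0 1" "comp4 C 0 2 3 1 = comp4 C 3 1 0 2" "comp4 C 0 2 1 2 = comp4 C 3 1 0 3"
    "comp4 C 0 3 2 3 = comp4 C 1 2 0 1" "comp4 C 0 3 3 1 = comp4 C 1 2 0 2" "comp4 C 0 3 1 2 = comp4 C 1 2 0 3"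
    "comp4 C 0 1 0 1 + comp4 C 0 2 0 2 + comp4 C 0 3 0 3 = 0"
    "comp4 C 2 3 0 1 + comp4 C 3 1 0 2 + comp4 C 1 2 0 3 = 0"
    unfolding normal using rels by linarith+
qed

text \<open>Expand twice. The first pair is expanded by \<open>sd_biv_expansion\<close>; its
  coefficients are bivectors in the second pair, self-dual by \<open>weyl_duality\<close>, so
  \<open>self_dual_expansion\<close> applies to them. Symmetry and vanishing trace of
  \<open>q\<close> come from the electric and magnetic parts.\<close>

lemma sd_weyl_biv:
  assumes "weyl_tensor g C"
  shows "\<exists>q. q 2 1 = q 1 2 \<and> q 3 1 = q 1 3 \<and> q 3 2 = q 2 3 \<and> q 1 1 + q 2 2 + q 3 3 = 0 \<and>
    (\<forall>a b c d. sd_weyl g C a b c d = (\<Sum>m\<in>{1,2,3}. \<Sum>n\<in>{1,2,3}. q m n * biv m a b * biv n c d))"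
proof -
  \<comment> \<open>For m, i, j cyclic, \<open>- y m i j c d\<close> is the coefficient of
    \<open>biv m\<close> in the first expansion.\<close>
  define y where "y m i j c d = comp2 (\<lambda>a b. complex_of_real (C a b c d)) 0 m
    - \<i> * comp2 (\<lambda>a b. complex_of_real (C a b c d)) i j" for m i j c d
  have pair_comp: "comp4 C i j k l = comp4 C k l i j" for i j k l
    using assms unfolding weyl_tensor_def by (intro comp4_pair) blast
  have anti_comp: "comp4 C i j k l = - comp4 C i j l k" for i j k l
    using assms pair_comp comp4_antisym1[of C] unfolding weyl_tensor_def by metis
  have anti1: "C a b c d = - C b a c d" and pair: "C a b c d = C c d a b" for a b c d
    using assms unfolding weyl_tensor_def by blast+
  have sd: "sd_weyl g C a b c d = - (y 1 2 3 c d * biv 1 a b + y 2 3 1 c d * biv 2 a b + y 3 1 2 c d * biv 3 a b)"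
    for a b c d
  proof -
    have "sd_weyl g C a b c d = sd_biv g (\<lambda>a b. complex_of_real (C a b c d)) a b"
      by (simp add: sd_weyl_def sd_biv_def dual4_def dual2_def)
    also have "\<dots> = - (y 1 2 3 c d * biv 1 a b + y 2 3 1 c d * biv 2 a b + y 3 1 2 c d * biv 3 a b)"
      unfolding y_def by (rule sd_biv_expansion) (metis anti1 of_real_minus)
    finally show ?thesis .
  qed
  have comp_y: "comp2 (y m i j) k l = complex_of_real (comp4 C 0 m k l) - \<i> * complex_of_real (comp4 C i j k l)" for m i j k l
  proof -
    have "comp2 (\<lambda>c d. comp2 (\<lambda>a b. complex_of_real (C a b c d)) i j) k l = complex_of_real (comp4 C i j k l)" for i j
      by (subst pair) (simp add: comp2_comp2 pair_comp[of k l i j])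
    then show ?thesis unfolding y_def by (simp add: comp2_linear)
  qed
  have y_anti: "comp2 (y m i j) k l = - comp2 (y m i j) l k" for m i j k l
    unfolding comp_y using anti_comp[of 0 m k l] anti_comp[of i j k l] by simp
  note y_exp = self_dual_expansion[OF y_anti, unfolded comp_y]
  define Q where "Q m i j n = 2 * (complex_of_real (comp4 C 0 m 0 n) - \<i> * complex_of_real (comp4 C i j 0 n))" for m i j n
  have y: "y m i j c d = - (Q m i j 1 * biv 1 c d + Q m i j 2 * biv 2 c d + Q m i j 3 * biv 3 c d)"
    if "(m, i, j) \<in> {(1,2,3),(2,3,1),(3,1,2)}" for m i j c d
    using that weyl_duality[OF assms] y_exp[of m i j] unfolding Q_def
    by (auto simp: algebra_simps)
  define q where "q m = (if m = 1 then Q 1 2 3 else if m = 2 then Q 2 3 1 else Q 3 1 2)" for m :: idx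
  show ?thesis
  proof (intro exI[of _ q] conjI allI)
    have "comp4 C 2 3 0 2 = comp4 C 3 1 0 1" "comp4 C 2 3 0 3 = comp4 C 1 2 0 1" "comp4 C 3 1 0 3 = comp4 C 1 2 0 2"
      using weyl_duality[OF assms] pair_comp[of 2 3 0 2] pair_comp[of 2 3 0 3] pair_comp[of 3 1 0 3]
      by simp_all
    then show "q 2 1 = q 1 2" "q 3 1 = q 1 3" "q 3 2 = q 2 3"
      using pair_comp[of 0 2 0 1] pair_comp[of 0 3 0 1] pair_comp[of 0 3 0 2]
      by (simp_all add: q_def Q_def)
    show "q 1 1 + q 2 2 + q 3 3 = 0"
    proof -
      have "q 1 1 + q 2 2 + q 3 3 = 2 * (complex_of_real (comp4 C 0 1 0 1 + comp4 C 0 2 0 2 + comp4 C 0 3 0 3)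
        - \<i> * complex_of_real (comp4 C 2 3 0 1 + comp4 C 3 1 0 2 + comp4 C 1 2 0 3))"
        by (simp add: q_def Q_def algebra_simps)
      then show ?thesis unfolding weyl_duality(19,20)[OF assms] by simp
    qed
    show "sd_weyl g C a b c d = (\<Sum>m\<in>{1,2,3}. \<Sum>n\<in>{1,2,3}. q m n * biv m a b * biv n c d)" for a b c d
      unfolding sd by (simp add: y q_def algebra_simps)
  qed
qed

end

subsection \<open>The Bel--Robinson tensor in a frame\<close>

text \<open>Common source of the alignment condition, which concerns its part orthogonal to
  \<open>t\<close>, and of the quartic form, which is its value at \<open>t\<close>.\<close>

definition supermomentum :: "real^4^4 \<Rightarrow> rtensor4 \<Rightarrow> real^4 \<Rightarrow> idx \<Rightarrow> complex" where
  "supermomentum g C t b = (\<Sum>c\<in>UNIV. \<Sum>d\<in>UNIV. \<Sum>e\<in>UNIV.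
      bel_robinson g C b c d e * complex_of_real (t$c * t$d * t$e))"

lemma br_quartic_supermomentum: "br_quartic g C t = Re (ev (supermomentum g C t) t)"
  unfolding br_quartic_def supermomentum_def ev_def
  by (simp add: sum_distrib_left sum_distrib_right mult_ac)

context orthonormal_frame
begin

definition biv_vec :: "idx \<Rightarrow> real^4 \<Rightarrow> idx \<Rightarrow> complex" where
  "biv_vec m w i = ev (\<lambda>r. ev (biv m r) w) (e i)"

text \<open>A Maxwell stress bilinear: one self-dual bivector contracted with the conjugate of
  another. The Bel-Robinson tensor is a combination of products of two such factors.\<close>

definition biv_prod :: "idx \<Rightarrow> idx \<Rightarrow> real^4 \<Rightarrow> real^4 \<Rightarrow> complex" where
  "biv_prod m n w t = (\<Sum>i\<in>UNIV. complex_of_real (mink i i) * biv_vec m w i * cnj (biv_vec n t i))"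

lemma biv_antisym: "biv m a b = - biv m b a"
proof -
  have "biv m = (\<lambda>a b. - biv m b a)"
  proof (rule comp2_eqI)
    fix i j
    have "comp2 (\<lambda>a b. - biv m b a) i j = - comp2 (biv m) j i"
      unfolding comp2_linear comp2_def by (subst ev_swap) (rule refl)
    moreover have "comp2 (biv m) i j = - comp2 (biv m) j i"
      unfolding comp2_biv by (subst levi_civita_antisym) (simp add: algebra_simps)
    ultimately show "comp2 (biv m) i j = comp2 (\<lambda>a b. - biv m b a) i j" by simp
  qed
  then show ?thesis by meson
qed

text \<open>The contraction over r, p meets only the first bivectors of the two self-dual Weyl
  factors, and that over s, q only the second ones. Each term therefore splits into two factors
  \<open>biv_prod\<close>.\<close>

lemma supermomentum_eq:
  assumes sd: "\<And>a b c d. sd_weyl g C a b c d = (\<Sum>m\<in>{1,2,3}. \<Sum>n\<in>{1,2,3}. q m n * biv m a b * biv n c d)"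
  shows "ev (supermomentum g C t) w = (\<Sum>m\<in>{1,2,3}. \<Sum>n\<in>{1,2,3}. \<Sum>k\<in>{1,2,3}. \<Sum>l\<in>{1,2,3}.
    q m n * cnj (q k l) * biv_prod m k w t * biv_prod n l t t)"
proof -
  \<comment> \<open>The minus sign appears because \<open>t\<close> fills the first slot of the
    second bivector, whereas \<open>biv_vec\<close> fills the second slot. It cancels in the product
    of \<open>Z\<close> with its conjugate.\<close>
  define Z where "Z v i j = (\<Sum>m\<in>{1,2,3}. \<Sum>n\<in>{1,2,3}. q m n * biv_vec m v i * - biv_vec n t j)" for v i j
  have 1: "ev (\<lambda>a. ev (\<lambda>r. biv m r a) (e i)) v = biv_vec m v i" for m i v
    unfolding biv_vec_def by (rule ev_swap)
  have 2: "ev (\<lambda>b. ev (biv m b) (e j)) t = - biv_vec m t j" for m j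
    unfolding biv_vec_def by (subst ev_swap, subst biv_antisym) (simp only: ev_minus)
  have Z: "ev (\<lambda>a. ev (\<lambda>b. comp2 (\<lambda>r s. sd_weyl g C r a b s) i j) t) v = Z v i j" for v i j
    unfolding sd comp2_def Z_def by (simp only: ev_linear 1 2)
  have Z': "ev (\<lambda>a. ev (\<lambda>b. comp2 (\<lambda>r s. cnj (sd_weyl g C r a b s)) i j) t) v = cnj (Z v i j)" for v i j
    unfolding Z[symmetric] comp2_def ev_cnj by (rule refl)
  have br: "bel_robinson g C a b c d = (\<Sum>i\<in>UNIV. \<Sum>j\<in>UNIV. complex_of_real (mink i i) * complex_of_real (mink j j) *
    comp2 (\<lambda>r s. sd_weyl g C r a b s) i j * comp2 (\<lambda>p q. cnj (sd_weyl g C p c d q)) i j)" for a b c d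
    unfolding ginv_contract2[symmetric] bel_robinson_def by simp
  have "ev (supermomentum g C t) w = ev (\<lambda>a. ev (\<lambda>b. ev (\<lambda>c. ev (\<lambda>d. bel_robinson g C a b c d) t) t) t) w"
    unfolding supermomentum_def ev_def
    by (simp add: sum_distrib_left sum_distrib_right mult_ac)
  also have "\<dots> = (\<Sum>i\<in>UNIV. \<Sum>j\<in>UNIV. complex_of_real (mink i i) * complex_of_real (mink j j) *
      Z w i j * cnj (Z t i j))"
    unfolding br by (simp only: ev_linear Z Z')
  also have "\<dots> = (\<Sum>i\<in>UNIV. \<Sum>j\<in>UNIV. \<Sum>m\<in>{1,2,3}. \<Sum>n\<in>{1,2,3}. \<Sum>k\<in>{1,2,3}. \<Sum>l\<in>{1,2,3}.
      q m n * cnj (q k l) * ((complex_of_real (mink i i) * biv_vec m w i * cnj (biv_vec k t i))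
       * (complex_of_real (mink j j) * biv_vec n t j * cnj (biv_vec l t j))))"
    unfolding Z_def cnj_sum mult.assoc[of "complex_of_real _ * complex_of_real _"]
    unfolding sum_distrib_right unfolding sum_distrib_left
    by (intro sum.cong refl) simp
  also have "\<dots> = (\<Sum>m\<in>{1,2,3}. \<Sum>n\<in>{1,2,3}. \<Sum>k\<in>{1,2,3}. \<Sum>l\<in>{1,2,3}. \<Sum>i\<in>UNIV. \<Sum>j\<in>UNIV.
      q m n * cnj (q k l) * ((complex_of_real (mink i i) * biv_vec m w i * cnj (biv_vec k t i))
       * (complex_of_real (mink j j) * biv_vec n t j * cnj (biv_vec l t j))))"
    by (subst sum_swap_pairs, rule sum.cong[OF refl], rule sum.cong[OF refl], rule sum_swap_pairs)
  also have "\<dots> = (\<Sum>m\<in>{1,2,3}. \<Sum>n\<in>{1,2,3}. \<Sum>k\<in>{1,2,3}. \<Sum>l\<in>{1,2,3}.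
    q m n * cnj (q k l) * biv_prod m k w t * biv_prod n l t t)"
    unfolding sum_distrib_left[symmetric] sum_distrib_right[symmetric] biv_prod_def
    by (simp only: mult.assoc)
  finally show ?thesis .
qed

lemma biv_vec_frame:
  "biv_vec m (\<Sum>k\<in>UNIV. t k *\<^sub>R e k) i = (\<Sum>k\<in>UNIV. complex_of_real (t k) * comp2 (biv m) i k)"
  unfolding biv_vec_def ev_vec_sum ev_vec_scaleR comp2_def ev_linear ..

lemma biv_vec_basis: "biv_vec m (e k) i = comp2 (biv m) i k"
  by (simp add: biv_vec_def comp2_def)

lemma biv_prod_frame:
  fixes t :: "idx \<Rightarrow> real"
  defines "v \<equiv> \<Sum>k\<in>UNIV. t k *\<^sub>R e k"
  shows "biv_prod 1 1 v v = complex_of_real (((t 1)\<^sup>2 - (t 0)\<^sup>2 - (t 2)\<^sup>2 - (t 3)\<^sup>2) / 4)"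
    "biv_prod 2 2 v v = complex_of_real (((t 2)\<^sup>2 - (t 0)\<^sup>2 - (t 1)\<^sup>2 - (t 3)\<^sup>2) / 4)"
    "biv_prod 3 3 v v = complex_of_real (((t 3)\<^sup>2 - (t 0)\<^sup>2 - (t 1)\<^sup>2 - (t 2)\<^sup>2) / 4)"
    "biv_prod 1 2 v v = Complex (t 1 * t 2 / 2) (t 0 * t 3 / 2)"
    "biv_prod 2 3 v v = Complex (t 2 * t 3 / 2) (t 0 * t 1 / 2)"
    "biv_prod 3 1 v v = Complex (t 3 * t 1 / 2) (t 0 * t 2 / 2)"
    "biv_prod 2 1 v v = Complex (t 1 * t 2 / 2) (- t 0 * t 3 / 2)"
    "biv_prod 3 2 v v = Complex (t 2 * t 3 / 2) (- t 0 * t 1 / 2)"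
    "biv_prod 1 3 v v = Complex (t 3 * t 1 / 2) (- t 0 * t 2 / 2)"
  unfolding biv_prod_def v_def biv_vec_frame unfolding sum_idx
  by (simp_all add: biv_table complex_eq_iff power2_eq_square field_simps)

text \<open>Contracted with \<open>e 0\<close>, the bivector \<open>biv n\<close> has
  \<open>n\<close> as its only nonzero frame component, with value 1/2. The minus sign is
  \<open>mink n n\<close>.\<close>

lemma biv_prod_time: "biv_prod m n w (e 0) = - (1/2) * biv_vec m w n" if "n \<in> {1,2,3}"
  using that unfolding biv_prod_def biv_vec_basis sum_idx by (auto simp: biv_table)

text \<open>The super-Poynting vector: up to the factor 1/8, these are off-diagonal entries of the
  imaginary part of \<open>q\<close> times its adjoint. For symmetric \<open>q\<close> that is the
  commutator of its imaginary and real parts.\<close>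

lemma supermomentum_time:
  assumes sd: "\<And>a b c d. sd_weyl g C a b c d = (\<Sum>m\<in>{1,2,3}. \<Sum>n\<in>{1,2,3}. q m n * biv m a b * biv n c d)"
  shows "ev (supermomentum g C (e 0)) (e 1) = complex_of_real (Im (\<Sum>n\<in>{1,2,3}. q 2 n * cnj (q 3 n)) / 8)"
    "ev (supermomentum g C (e 0)) (e 2) = complex_of_real (Im (\<Sum>n\<in>{1,2,3}. q 3 n * cnj (q 1 n)) / 8)"
    "ev (supermomentum g C (e 0)) (e 3) = complex_of_real (Im (\<Sum>n\<in>{1,2,3}. q 1 n * cnj (q 2 n)) / 8)"
  unfolding supermomentum_eq[OF sd]
  by (simp_all add: biv_prod_time biv_vec_basis biv_table complex_eq_iff field_simps)

end

subsection \<open>Existence of adapted frames and Petrov eigenvalues\<close>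

lemma gdot_add_left: "gdot g (x + y) z = gdot g x z + gdot g y z"
  and gdot_add_right: "gdot g z (x + y) = gdot g z x + gdot g z y"
  by (simp_all add: gdot_def algebra_simps sum.distrib)

lemma gdot_scaleR_left: "gdot g (c *\<^sub>R x) z = c * gdot g x z"
  and gdot_scaleR_right: "gdot g z (c *\<^sub>R x) = c * gdot g z x"
  by (simp_all add: gdot_def sum_distrib_left mult_ac)

lemma gdot_minus_left: "gdot g (- x) z = - gdot g x z"
  and gdot_minus_right: "gdot g z (- x) = - gdot g z x"
  using gdot_scaleR_left[of g "-1" x z] gdot_scaleR_right[of g z "-1" x] by simp_all

lemma gdot_diff_left: "gdot g (x - y) z = gdot g x z - gdot g y z"
  and gdot_diff_right: "gdot g z (x - y) = gdot g z x - gdot g z y"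
  by (simp_all add: gdot_def algebra_simps sum_subtractf)

lemmas gdot_linear = gdot_add_left gdot_add_right gdot_scaleR_left gdot_scaleR_right
  gdot_minus_left gdot_minus_right gdot_diff_left gdot_diff_right

lemma gdot_commute:
  assumes "\<And>a b. g$a$b = g$b$a"
  shows "gdot g x y = gdot g y x"
  unfolding gdot_def by (subst sum.swap) (simp add: assms mult_ac)

text \<open>Reversing one spatial vector changes the sign of the determinant and keeps the time
  vector, so one of the two frames is oriented.\<close>

lemma orthonormal_frame_or_flip:
  assumes "\<And>a b. g$a$b = g$b$a" and orth: "\<And>i j. gdot g (e i) (e j) = mink i j"
  shows "orthonormal_frame g e \<or> orthonormal_frame g (e(1 := - e 1))"
proof -
  have "det (\<chi> i. (e(1 := - e 1)) i) = - det (\<chi> i. e i)"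
    by (simp add: det_idx algebra_simps)
  moreover have "det (\<chi> i. e i) \<noteq> 0"
    using orthonormal_det[of g e, OF orth] by auto
  moreover have "gdot g ((e(1 := - e 1)) i) ((e(1 := - e 1)) j) = mink i j" for i j
    by (auto simp: orth gdot_minus_left gdot_minus_right mink_def)
  ultimately show ?thesis
    using assms unfolding orthonormal_frame_def by (smt (verit))
qed

text \<open>The map is the reflection in the hyperplane orthogonal to the non-null vector
  \<open>n\<close>, hence an isometry.\<close>

lemma gdot_reflection:
  assumes sym: "\<And>a b. g$a$b = g$b$a" and "gdot g n n \<noteq> 0"
  shows "gdot g (x + (- 2 * gdot g x n / gdot g n n) *\<^sub>R n) (y + (- 2 * gdot g y n / gdot g n n) *\<^sub>R n)
    = gdot g x y"
  using assms(2) gdot_commute[OF sym, of n y]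
  by (simp add: gdot_linear field_simps)

text \<open>The reflection along the difference of two distinct unit timelike vectors interchanges
  them, so it carries a given orthonormal frame to one that starts with \<open>u\<close>.\<close>

lemma exists_orthonormal_frame:
  assumes "lorentz_metric g" and u: "gdot g u u = 1"
  obtains e where "orthonormal_frame g e" "e 0 = u"
proof -
  have sym: "g$a$b = g$b$a" for a b using assms by (simp add: lorentz_metric_def)
  obtain e0 where e0: "\<And>i j. gdot g (e0 i) (e0 j) = mink i j"
    using assms by (auto simp: lorentz_metric_def)
  \<comment> \<open>The sign keeps \<open>gdot g (e1 0) u\<close> away from 1, which makes the
    vector \<open>n\<close> below non-null.\<close>
  define c :: real where "c = (if gdot g (e0 0) u = 1 then -1 else 1)"
  define e1 where "e1 = e0(0 := c *\<^sub>R e0 0)"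
  have e1: "gdot g (e1 i) (e1 j) = mink i j" for i j
    by (auto simp: e1_def e0 gdot_linear mink_def c_def)
  have ne: "gdot g (e1 0) u \<noteq> 1"
    by (simp add: e1_def gdot_linear c_def)
  define n where "n = e1 0 + (-1) *\<^sub>R u"
  have nn: "gdot g n n = 2 - 2 * gdot g (e1 0) u"
    using gdot_commute[OF sym, of u "e1 0"] by (simp add: n_def gdot_linear e1 u mink_def)
  have en: "gdot g (e1 0) n = 1 - gdot g (e1 0) u"
    by (simp add: n_def gdot_linear e1 mink_def)
  define e2 where "e2 i = e1 i + (- 2 * gdot g (e1 i) n / gdot g n n) *\<^sub>R n" for i
  have e2: "gdot g (e2 i) (e2 j) = mink i j" for i j
    unfolding e2_def using gdot_reflection[OF sym, of n "e1 i" "e1 j"] nn ne e1 by simp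
  have "- 2 * gdot g (e1 0) n / gdot g n n = -1"
    using ne by (simp add: nn en field_simps)
  then have "e2 0 = u" by (simp add: e2_def n_def)
  moreover have "(e2(1 := - e2 1)) 0 = e2 0" by simp
  ultimately show ?thesis
    using orthonormal_frame_or_flip[of g e2, OF sym e2] that by metis
qed

text \<open>A canonical tetrad may have either orientation. Reversing \<open>x\<close> reverses its
  bivector, which enters the self-dual Weyl tensor quadratically.\<close>

lemma canonical_petrov_tetrad_frame:
  assumes "lorentz_metric g" and can: "canonical_petrov_tetrad g tau C v x y z s1 s2 s3"
  obtains e where "orthonormal_frame g e" "e 0 = v"
    "\<And>a b c d. sd_weyl g C a b c d = s1 * sd_wedge g v (e 1) a b * sd_wedge g v (e 1) c d
      + s2 * sd_wedge g v (e 2) a b * sd_wedge g v (e 2) c d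
      + s3 * sd_wedge g v (e 3) a b * sd_wedge g v (e 3) c d"
proof -
  have sym: "g$a$b = g$b$a" for a b using assms by (simp add: lorentz_metric_def)
  define e where "e i = (if i = 0 then v else if i = 1 then x else if i = 2 then y else z)" for i :: idx
  have "\<forall>i j. gdot g (e i) (e j) = mink i j"
    unfolding all_idx using can gdot_commute[OF sym]
    by (simp add: e_def mink_def canonical_petrov_tetrad_def)
  then have orth: "gdot g (e i) (e j) = mink i j" for i j by blast
  have sd: "sd_weyl g C a b c d = s1 * sd_wedge g v x a b * sd_wedge g v x c d
      + s2 * sd_wedge g v y a b * sd_wedge g v y c d + s3 * sd_wedge g v z a b * sd_wedge g v z c d" for a b c d
    using can by (simp add: canonical_petrov_tetrad_def Let_def sd_wedge_def)
  have "sd_wedge g v (- x) a b = - sd_wedge g v x a b" for a b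
    using sd_wedge_scaleR[of g v "-1" x a b] by simp
  then show ?thesis
    using orthonormal_frame_or_flip[of g e, OF sym orth] that[of e] that[of "e(1 := - e 1)"]
    by (auto simp: e_def sd)
qed

lemma sd_biv_self_dual:
  assumes "\<And>a b. dual2 g X a b = \<i> * X a b"
  shows "sd_biv g X a b = X a b"
  by (simp add: sd_biv_def assms)

context orthonormal_frame
begin

text \<open>In the basis \<open>biv\<close> the Weyl operator on self-dual bivectors is diagonal.
  Half the contraction of \<open>X\<close> with \<open>biv m\<close> is \<open>comp2 X 0 m\<close>,
  and \<open>biv m\<close> has electric component -1/2; this gives the eigenvalues
  \<open>- s1 / 2\<close>, \<open>- s2 / 2\<close>, \<open>- s3 / 2\<close>.\<close>

lemma petrov_eigenvalue_cases:
  assumes sd: "\<And>a b c d. sd_weyl g C a b c d = s1 * biv 1 a b * biv 1 c d + s2 * biv 2 a b * biv 2 c d + s3 * biv 3 a b * biv 3 c d"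
    and "petrov_eigenvalue g C l"
  shows "l \<in> {- s1 / 2, - s2 / 2, - s3 / 2}"
proof -
  obtain X where anti: "\<And>a b. X a b = - X b a" and nz: "\<exists>a b. X a b \<noteq> 0"
    and dual: "\<And>a b. dual2 g X a b = \<i> * X a b"
    and eig: "\<And>a b. (1/2) * (\<Sum>c\<in>UNIV. \<Sum>d\<in>UNIV. \<Sum>p\<in>UNIV. \<Sum>q\<in>UNIV.
              complex_of_real (C a b c d * ginv g c p * ginv g d q) * X p q) = l * X a b"
    using assms(2) unfolding petrov_eigenvalue_def by blast
  have anti': "comp2 X i j = - comp2 X j i" for i j using anti by (rule comp2_antisym)
  have "dual2 g X = (\<lambda>a b. \<i> * X a b)" using dual by blast
  then have "comp2 (dual2 g X) i j = \<i> * comp2 X i j" for i j by (simp only: comp2_linear)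
  then have self_dual: "comp2 X 2 3 = \<i> * comp2 X 0 1" "comp2 X 3 1 = \<i> * comp2 X 0 2" "comp2 X 1 2 = \<i> * comp2 X 0 3"
    using comp2_dual2_table[OF anti'] by simp_all
  define K where "K c d = (1/2) * (\<Sum>p\<in>UNIV. \<Sum>q\<in>UNIV.
      complex_of_real (ginv g c p) * complex_of_real (ginv g d q) * X p q)" for c d
  have eigK: "(\<Sum>c\<in>UNIV. \<Sum>d\<in>UNIV. K c d * complex_of_real (C a b c d)) = l * X a b" for a b
    unfolding eig[symmetric] K_def sum_distrib_left sum_distrib_right by (simp add: mult_ac)
  \<comment> \<open>Take the self-dual part of the eigenvalue equation in its free indices; the
    right-hand side is unchanged because \<open>X\<close> is self-dual.\<close>
  have sdK: "(\<Sum>c\<in>UNIV. \<Sum>d\<in>UNIV. K c d * sd_weyl g C a b c d) = l * X a b" for a b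
  proof -
    have "sd_weyl g C a b c d = sd_biv g (\<lambda>a b. complex_of_real (C a b c d)) a b" for c d
      by (simp add: sd_weyl_def sd_biv_def dual4_def dual2_def)
    then have "(\<Sum>c\<in>UNIV. \<Sum>d\<in>UNIV. K c d * sd_weyl g C a b c d)
      = sd_biv g (\<lambda>a b. \<Sum>c\<in>UNIV. \<Sum>d\<in>UNIV. K c d * complex_of_real (C a b c d)) a b"
      by (simp add: sd_biv_sum sd_biv_cmult)
    then show ?thesis unfolding eigK by (simp add: sd_biv_cmult sd_biv_self_dual dual)
  qed
  have K: "(\<Sum>c\<in>UNIV. \<Sum>d\<in>UNIV. K c d * biv m c d) = comp2 X 0 m" if "m \<in> {1,2,3}" for m
  proof -
    have "(\<Sum>c\<in>UNIV. \<Sum>d\<in>UNIV. K c d * biv m c d) = (1/2) * (\<Sum>c\<in>UNIV. \<Sum>d\<in>UNIV. \<Sum>p\<in>UNIV. \<Sum>q\<in>UNIV.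
        complex_of_real (ginv g c p) * complex_of_real (ginv g d q) * biv m c d * X p q)"
      unfolding K_def sum_distrib_left sum_distrib_right by (simp add: mult_ac)
    also have "\<dots> = comp2 X 0 m"
      using that unfolding ginv_contract2 unfolding sum_idx
      using self_dual anti'[of 1 0] anti'[of 2 0] anti'[of 3 0] anti'[of 1 3] anti'[of 3 2] anti'[of 2 1]
      by (auto simp: biv_table)
    finally show ?thesis .
  qed
  have "(\<lambda>a b. l * X a b) = (\<lambda>a b. (s1 * comp2 X 0 1) * biv 1 a b + (s2 * comp2 X 0 2) * biv 2 a b
      + (s3 * comp2 X 0 3) * biv 3 a b)"
  proof (intro ext)
    fix a b
    have "(\<Sum>c\<in>UNIV. \<Sum>d\<in>UNIV. K c d * sd_weyl g C a b c d)
      = s1 * biv 1 a b * (\<Sum>c\<in>UNIV. \<Sum>d\<in>UNIV. K c d * biv 1 c d)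
      + s2 * biv 2 a b * (\<Sum>c\<in>UNIV. \<Sum>d\<in>UNIV. K c d * biv 2 c d)
      + s3 * biv 3 a b * (\<Sum>c\<in>UNIV. \<Sum>d\<in>UNIV. K c d * biv 3 c d)"
      unfolding sd sum_distrib_left sum.distrib[symmetric] by (simp add: algebra_simps)
    then show "l * X a b = (s1 * comp2 X 0 1) * biv 1 a b + (s2 * comp2 X 0 2) * biv 2 a b
      + (s3 * comp2 X 0 3) * biv 3 a b"
      by (simp add: sdK K mult_ac)
  qed
  then have "comp2 (\<lambda>a b. l * X a b) 0 m = comp2 (\<lambda>a b. (s1 * comp2 X 0 1) * biv 1 a b + (s2 * comp2 X 0 2) * biv 2 a b
      + (s3 * comp2 X 0 3) * biv 3 a b) 0 m" for m
    by simp
  from this[of 1] this[of 2] this[of 3]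
  have eqs: "l * comp2 X 0 1 = - s1 / 2 * comp2 X 0 1" "l * comp2 X 0 2 = - s2 / 2 * comp2 X 0 2"
    "l * comp2 X 0 3 = - s3 / 2 * comp2 X 0 3"
    by (simp_all only: comp2_linear) (simp_all add: biv_table)
  have "comp2 X 0 1 \<noteq> 0 \<or> comp2 X 0 2 \<noteq> 0 \<or> comp2 X 0 3 \<noteq> 0"
    using nz self_dual_expansion[OF anti' self_dual] by auto
  then show ?thesis using eqs[unfolded mult_cancel_right] by blast
qed

end

subsection \<open>Extremality of the quartic form\<close>

lemma boost_form_pos:
  fixes t0 t1 t2 t3 :: real and d1 d2 :: complex
  assumes unit: "t0\<^sup>2 = 1 + t1\<^sup>2 + t2\<^sup>2 + t3\<^sup>2" and nz: "t1 \<noteq> 0 \<or> t2 \<noteq> 0 \<or> t3 \<noteq> 0"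
    and d: "d1 \<noteq> 0" "d2 \<noteq> 0" "d1 + d2 \<noteq> 0"
  shows "0 < (t0\<^sup>2 * t1\<^sup>2 - t2\<^sup>2 * t3\<^sup>2) * (cmod d1)\<^sup>2 + (t0\<^sup>2 * t2\<^sup>2 - t3\<^sup>2 * t1\<^sup>2) * (cmod d2)\<^sup>2
    + (t0\<^sup>2 * t3\<^sup>2 - t1\<^sup>2 * t2\<^sup>2) * (cmod (d1 + d2))\<^sup>2 - 4 * t0 * t1 * t2 * t3 * Im (d1 * cnj d2)"
    (is "0 < ?form")
proof -
  \<comment> \<open>\<open>\<sigma>\<close> vanishes exactly when at most one of \<open>t1\<close>,
    \<open>t2\<close>, \<open>t3\<close> is nonzero. The form is then a sum of nonnegative terms,
    one of them positive.\<close>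
  define \<sigma> where "\<sigma> = t1\<^sup>2 * t2\<^sup>2 + t2\<^sup>2 * t3\<^sup>2 + t3\<^sup>2 * t1\<^sup>2"
  have "\<sigma> \<ge> 0" by (simp add: \<sigma>_def)
  show ?thesis
  proof (cases "\<sigma> = 0")
    case True
    then have z: "t1 * t2 = 0" "t2 * t3 = 0" "t3 * t1 = 0"
      by (auto simp: \<sigma>_def add_nonneg_eq_0_iff)
    have t0: "t0\<^sup>2 > 0" using unit by (simp add: add_pos_nonneg)
    have "cmod d1 > 0" "cmod d2 > 0" "cmod (d1 + d2) > 0" using d by simp_all
    then have "0 < t0\<^sup>2 * (t1\<^sup>2 * (cmod d1)\<^sup>2 + t2\<^sup>2 * (cmod d2)\<^sup>2 + t3\<^sup>2 * (cmod (d1 + d2))\<^sup>2)"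
      using t0 nz by (intro mult_pos_pos) (auto simp: add_pos_nonneg add_nonneg_pos)
    also have "\<dots> = ?form"
      using z by (auto simp: algebra_simps)
    finally show ?thesis .
  next
    case False
    \<comment> \<open>\<open>P\<close> is the coefficient of \<open>(cmod d1)\<^sup>2\<close> in the
      form and \<open>Complex c (- k)\<close> carries the cross term. Multiplying by
      \<open>P\<close> completes the square, with the determinant of the form as coefficient of
      \<open>(cmod d2)\<^sup>2\<close>.\<close>
    define P where "P = (t0\<^sup>2 - t2\<^sup>2) * (t1\<^sup>2 + t3\<^sup>2)"
    define c where "c = t0\<^sup>2 * t3\<^sup>2 - t1\<^sup>2 * t2\<^sup>2"
    define k where "k = 2 * t0 * t1 * t2 * t3"
    have "P > 0"
    proof -
      have "t1 \<noteq> 0 \<or> t3 \<noteq> 0" using False by (auto simp: \<sigma>_def)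
      then have "t1\<^sup>2 + t3\<^sup>2 > 0" by (simp add: sum_power2_gt_zero_iff)
      moreover have "t0\<^sup>2 - t2\<^sup>2 > 0" using unit by (simp add: add_pos_nonneg)
      ultimately show ?thesis by (simp add: P_def)
    qed
    \<comment> \<open>Eliminating \<open>t0\<close> by the unit condition leaves
      \<open>\<sigma>\<close> plus nonnegative monomials.\<close>
    have "t0\<^sup>2 * \<sigma> - t1\<^sup>2 * t2\<^sup>2 * t3\<^sup>2
        = \<sigma> + t1\<^sup>2 * t1\<^sup>2 * t2\<^sup>2 + t1\<^sup>2 * t1\<^sup>2 * t3\<^sup>2 + t2\<^sup>2 * t2\<^sup>2 * t1\<^sup>2 + t2\<^sup>2 * t2\<^sup>2 * t3\<^sup>2
         + t3\<^sup>2 * t3\<^sup>2 * t1\<^sup>2 + t3\<^sup>2 * t3\<^sup>2 * t2\<^sup>2 + 2 * (t1\<^sup>2 * t2\<^sup>2 * t3\<^sup>2)"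
      unfolding unit \<sigma>_def by (simp add: algebra_simps)
    moreover have "\<sigma> > 0" using False \<open>\<sigma> \<ge> 0\<close> by simp
    ultimately have det: "t0\<^sup>2 * \<sigma> - t1\<^sup>2 * t2\<^sup>2 * t3\<^sup>2 > 0"
      by (smt (verit) mult_nonneg_nonneg zero_le_power2)
    have "P * ?form = (cmod (complex_of_real P * d1 + Complex c (- k) * d2))\<^sup>2
        + (t0\<^sup>2 - t1\<^sup>2 - t2\<^sup>2 - t3\<^sup>2) * (t0\<^sup>2 * \<sigma> - t1\<^sup>2 * t2\<^sup>2 * t3\<^sup>2) * (cmod d2)\<^sup>2"
      unfolding P_def c_def k_def \<sigma>_def cmod_power2
      by (simp add: power2_eq_square algebra_simps)
    moreover have "t0\<^sup>2 - t1\<^sup>2 - t2\<^sup>2 - t3\<^sup>2 = 1" using unit by simp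
    ultimately have "P * ?form > 0"
      using det d by (simp add: add_nonneg_pos)
    then show ?thesis using \<open>P > 0\<close> by (simp add: zero_less_mult_iff)
  qed
qed

section \<open>The quartic form in a canonical frame\<close>

context orthonormal_frame
begin

text \<open>For diagonal \<open>q\<close> only the terms with
  \<open>(biv_prod m n v v)\<^sup>2\<close> survive. They are grouped into the invariant norm of the
  vector and the form of \<open>boost_form_pos\<close>, with d1 = s2 - s3 and d2 = s3 - s1.\<close>

lemma br_quartic_diagonal:
  assumes sd: "\<And>a b c d. sd_weyl g C a b c d = s1 * biv 1 a b * biv 1 c d + s2 * biv 2 a b * biv 2 c d + s3 * biv 3 a b * biv 3 c d"
    and s3: "s1 + s2 + s3 = 0"
  shows "16 * br_quartic g C (\<Sum>k\<in>UNIV. t k *\<^sub>R e k) =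
    ((cmod s1)\<^sup>2 + (cmod s2)\<^sup>2 + (cmod s3)\<^sup>2) * ((t 0)\<^sup>2 - (t 1)\<^sup>2 - (t 2)\<^sup>2 - (t 3)\<^sup>2)\<^sup>2
    + 4 * (((t 0)\<^sup>2 * (t 1)\<^sup>2 - (t 2)\<^sup>2 * (t 3)\<^sup>2) * (cmod (s2 - s3))\<^sup>2
    + ((t 0)\<^sup>2 * (t 2)\<^sup>2 - (t 3)\<^sup>2 * (t 1)\<^sup>2) * (cmod (s3 - s1))\<^sup>2
    + ((t 0)\<^sup>2 * (t 3)\<^sup>2 - (t 1)\<^sup>2 * (t 2)\<^sup>2) * (cmod ((s2 - s3) + (s3 - s1)))\<^sup>2
    - 4 * t 0 * t 1 * t 2 * t 3 * Im ((s2 - s3) * cnj (s3 - s1)))"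
proof -
  define q where "q m n = (if m = n then if m = 1 then s1 else if m = 2 then s2 else s3 else 0)" for m n :: idx
  let ?v = "\<Sum>k\<in>UNIV. t k *\<^sub>R e k"
  have sd': "sd_weyl g C a b c d = (\<Sum>m\<in>{1,2,3}. \<Sum>n\<in>{1,2,3}. q m n * biv m a b * biv n c d)" for a b c d
    unfolding sd by (simp add: q_def)
  have quartic: "ev (supermomentum g C ?v) ?v =
      s1 * cnj s1 * (biv_prod 1 1 ?v ?v)\<^sup>2 + s1 * cnj s2 * (biv_prod 1 2 ?v ?v)\<^sup>2 + s1 * cnj s3 * (biv_prod 1 3 ?v ?v)\<^sup>2
    + s2 * cnj s1 * (biv_prod 2 1 ?v ?v)\<^sup>2 + s2 * cnj s2 * (biv_prod 2 2 ?v ?v)\<^sup>2 + s2 * cnj s3 * (biv_prod 2 3 ?v ?v)\<^sup>2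
    + s3 * cnj s1 * (biv_prod 3 1 ?v ?v)\<^sup>2 + s3 * cnj s2 * (biv_prod 3 2 ?v ?v)\<^sup>2 + s3 * cnj s3 * (biv_prod 3 3 ?v ?v)\<^sup>2"
    unfolding supermomentum_eq[OF sd'] by (simp add: q_def power2_eq_square add_ac mult_ac)
  have "s3 = (s1 + s2 + s3) - s1 - s2" by simp
  then have s3': "s3 = - s1 - s2" unfolding s3 by simp
  show ?thesis
    unfolding br_quartic_supermomentum quartic biv_prod_frame cmod_power2 s3'
    by (simp add: power2_eq_square) (simp add: field_simps)
qed


lemma gdot_frame:
  "gdot g (\<Sum>k\<in>UNIV. t k *\<^sub>R e k) (\<Sum>k\<in>UNIV. t k *\<^sub>R e k)
    = (t 0)\<^sup>2 - (t 1)\<^sup>2 - (t 2)\<^sup>2 - (t 3)\<^sup>2"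
  unfolding sum_idx by (simp add: gdot_linear orthonormal mink_def power2_eq_square)

lemma br_quartic_time:
  assumes sd: "\<And>a b c d. sd_weyl g C a b c d = s1 * biv 1 a b * biv 1 c d + s2 * biv 2 a b * biv 2 c d + s3 * biv 3 a b * biv 3 c d"
    and "s1 + s2 + s3 = 0"
  shows "br_quartic g C (e 0) = ((cmod s1)\<^sup>2 + (cmod s2)\<^sup>2 + (cmod s3)\<^sup>2) / 16"
proof -
  have "(\<Sum>k\<in>UNIV. (if k = 0 then 1 else 0) *\<^sub>R e k) = e 0"
    unfolding sum_idx by simp
  then show ?thesis
    using br_quartic_diagonal[OF assms, of "\<lambda>k. if k = 0 then 1 else 0"] by simp
qed

lemma br_quartic_strict_minimum:
  assumes sd: "\<And>a b c d. sd_weyl g C a b c d = s1 * biv 1 a b * biv 1 c d + s2 * biv 2 a b * biv 2 c d + s3 * biv 3 a b * biv 3 c d"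
    and s: "s1 + s2 + s3 = 0" and distinct: "s1 \<noteq> s2" "s2 \<noteq> s3" "s1 \<noteq> s3"
    and v: "future_unit_timelike g tau v" and e0: "gdot g (e 0) tau > 0" and "v \<noteq> e 0"
  shows "br_quartic g C (e 0) < br_quartic g C v"
proof -
  define t where "t k = mink k k * gdot g v (e k)" for k
  have t: "v = (\<Sum>k\<in>UNIV. t k *\<^sub>R e k)" unfolding t_def by (rule vector_frame)
  have unit: "(t 0)\<^sup>2 - (t 1)\<^sup>2 - (t 2)\<^sup>2 - (t 3)\<^sup>2 = 1"
    using v unfolding future_unit_timelike_def t gdot_frame by simp
  \<comment> \<open>Without spatial components \<open>v\<close> would be plus or minus
    \<open>e 0\<close>, and time orientation excludes the minus sign.\<close>
  have nz: "t 1 \<noteq> 0 \<or> t 2 \<noteq> 0 \<or> t 3 \<noteq> 0"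
  proof (rule ccontr)
    assume "\<not> ?thesis"
    then have "v = t 0 *\<^sub>R e 0" "(t 0)\<^sup>2 = 1" using unit by (simp_all add: t sum_idx)
    moreover have "t 0 > 0"
      using v e0 \<open>v = t 0 *\<^sub>R e 0\<close> by (simp add: future_unit_timelike_def gdot_linear zero_less_mult_iff)
    ultimately have "t 0 = 1" by (simp add: power2_eq_1_iff)
    then show False using \<open>v = t 0 *\<^sub>R e 0\<close> \<open>v \<noteq> e 0\<close> by simp
  qed
  have "(t 0)\<^sup>2 = 1 + (t 1)\<^sup>2 + (t 2)\<^sup>2 + (t 3)\<^sup>2" using unit by simp
  from boost_form_pos[OF this nz, of "s2 - s3" "s3 - s1"]
  have "16 * br_quartic g C v > (cmod s1)\<^sup>2 + (cmod s2)\<^sup>2 + (cmod s3)\<^sup>2"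
    unfolding t br_quartic_diagonal[OF sd s] unit using distinct by simp
  then show ?thesis by (simp add: br_quartic_time[OF sd s])
qed

section \<open>Alignment, critical points and the canonical tetrad\<close>

lemma alignment_iff:
  "(\<forall>a b. (1/2) * (complex_of_real (lower g (e 0) a) * P b - complex_of_real (lower g (e 0) b) * P a) = 0)
    \<longleftrightarrow> ev P (e 1) = 0 \<and> ev P (e 2) = 0 \<and> ev P (e 3) = 0"
proof -
  let ?X = "\<lambda>a b. complex_of_real (lower g (e 0) a) * P b - complex_of_real (lower g (e 0) b) * P a"
  \<comment> \<open>The frame components of the wedge with \<open>e 0\<close> are, up to sign, the
    spatial components of \<open>P\<close>, or zero.\<close>
  have comp: "comp2 ?X i j = complex_of_real (mink 0 i) * ev P (e j) - complex_of_real (mink 0 j) * ev P (e i)" for i j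
    unfolding comp2_def by (simp add: ev_linear ev_lower[OF metric_sym] orthonormal)
  have zero: "comp2 (\<lambda>a b. 0) i j = 0" for i j by (simp add: comp2_def ev_zero)
  have "(\<forall>a b. ?X a b = 0) \<longleftrightarrow> ?X = (\<lambda>a b. 0)" by (auto simp: fun_eq_iff)
  also have "\<dots> \<longleftrightarrow> (\<forall>i j. comp2 ?X i j = 0)"
  proof
    assume X: "?X = (\<lambda>a b. 0)"
    show "\<forall>i j. comp2 ?X i j = 0" unfolding X zero by simp
  next
    assume "\<forall>i j. comp2 ?X i j = 0"
    then show "?X = (\<lambda>a b. 0)" by (intro comp2_eqI) (simp only: zero)
  qed
  also have "\<dots> \<longleftrightarrow> ev P (e 1) = 0 \<and> ev P (e 2) = 0 \<and> ev P (e 3) = 0"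
    unfolding comp all_idx by (auto simp: mink_def)
  finally show ?thesis by simp
qed

text \<open>Follow the hyperbola of unit vectors obtained by boosting \<open>e 0\<close> towards
  \<open>e 1\<close>. The derivative of the quartic there is four times the sought component of the
  supermomentum.\<close>

lemma minimum_imp_critical:
  assumes "weyl_tensor g C" and e0: "gdot g (e 0) tau > 0"
    and min: "\<And>t. future_unit_timelike g tau t \<Longrightarrow> br_quartic g C (e 0) \<le> br_quartic g C t"
  shows "ev (supermomentum g C (e 0)) (e 1) = 0"
proof -
  obtain q where sym': "q 2 1 = q 1 2" "q 3 1 = q 1 3" "q 3 2 = q 2 3" and "q 1 1 + q 2 2 + q 3 3 = 0"
    and sd: "\<And>a b c d. sd_weyl g C a b c d = (\<Sum>m\<in>{1,2,3}. \<Sum>n\<in>{1,2,3}. q m n * biv m a b * biv n c d)"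
    using sd_weyl_biv[OF assms(1)] by blast
  define coord :: "real \<Rightarrow> idx \<Rightarrow> real" where
    "coord r k = (if k = 0 then sqrt (1 + r\<^sup>2) else if k = 1 then r else 0)" for r k
  define v where "v r = (\<Sum>k\<in>UNIV. coord r k *\<^sub>R e k)" for r
  define I1 where "I1 = Im (q 1 2 * cnj (q 1 3))"
  define I2 where "I2 = Im (q 2 2 * cnj (q 2 3)) + Im (q 2 3 * cnj (q 3 3))"
  \<comment> \<open>Sixteen times the quartic along the boost. At \<open>r = 0\<close> only the term
    with \<open>sqrt (1 + r\<^sup>2) * r\<close> has a nonzero derivative.\<close>
  define \<phi> where "\<phi> r = (cmod (q 1 1))\<^sup>2 + 2 * ((cmod (q 1 2))\<^sup>2 + (cmod (q 1 3))\<^sup>2) * (1 + 2 * r\<^sup>2)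
    + ((cmod (q 2 2))\<^sup>2 + (cmod (q 3 3))\<^sup>2 + 2 * (cmod (q 2 3))\<^sup>2) * (1 + 2 * r\<^sup>2)\<^sup>2
    + 8 * (sqrt (1 + r\<^sup>2) * r) * (I1 + (1 + 2 * r\<^sup>2) * I2)
    + 4 * ((1 + r\<^sup>2) * r\<^sup>2) * (2 * (cmod (q 2 3))\<^sup>2 - 2 * Re (q 2 2 * cnj (q 3 3)))" for r
  have \<phi>: "16 * br_quartic g C (v r) = \<phi> r" for r
  proof -
    define w where "w = sqrt (1 + r\<^sup>2)"
    have w: "w * w = 1 + r * r" unfolding w_def by (simp add: power2_eq_square[symmetric])
    have w': "w * (w * x) = (1 + r * r) * x" for x using w by (simp add: mult.assoc[symmetric])
    have prods: "biv_prod 1 1 (v r) (v r) = - 1 / 4" "biv_prod 2 2 (v r) (v r) = complex_of_real (- (1 + 2 * r\<^sup>2) / 4)"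
      "biv_prod 3 3 (v r) (v r) = complex_of_real (- (1 + 2 * r\<^sup>2) / 4)" "biv_prod 1 2 (v r) (v r) = 0"
      "biv_prod 2 1 (v r) (v r) = 0" "biv_prod 1 3 (v r) (v r) = 0" "biv_prod 3 1 (v r) (v r) = 0"
      "biv_prod 2 3 (v r) (v r) = Complex 0 (w * r / 2)" "biv_prod 3 2 (v r) (v r) = Complex 0 (- w * r / 2)"
      unfolding v_def biv_prod_frame coord_def w_def by (simp_all add: complex_eq_iff)
    show ?thesis
      unfolding br_quartic_supermomentum supermomentum_eq[OF sd] \<phi>_def I1_def I2_def cmod_power2 w_def[symmetric]
      by (simp add: prods sym') (simp add: power2_eq_square field_simps w w')
  qed
  have "((\<lambda>r. \<phi> r) has_real_derivative 8 * (I1 + I2)) (at 0)"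
    unfolding \<phi>_def by (auto intro!: derivative_eq_intros)
  \<comment> \<open>For \<open>r\<close> below this bound the contribution of \<open>e 1\<close> to
    the product with \<open>tau\<close> cannot outweigh that of \<open>e 0\<close>, so the curve
    stays future-pointing.\<close>
  moreover define \<delta> where "\<delta> = gdot g (e 0) tau / (\<bar>gdot g (e 1) tau\<bar> + 1)"
  moreover have "\<delta> > 0" using e0 by (simp add: \<delta>_def add_nonneg_pos)
  moreover have "\<phi> 0 \<le> \<phi> r" if "\<bar>0 - r\<bar> < \<delta>" for r
  proof -
    have "v 0 = e 0" unfolding v_def coord_def sum_idx by simp
    have "gdot g (v r) (v r) = 1"
      unfolding v_def gdot_frame by (simp add: coord_def)
    moreover have "gdot g (v r) tau > 0"
    proof -
      have "\<bar>r * gdot g (e 1) tau\<bar> \<le> \<bar>r\<bar> * (\<bar>gdot g (e 1) tau\<bar> + 1)"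
        by (simp add: abs_mult mult_left_mono)
      also have "\<dots> < gdot g (e 0) tau"
        using that by (simp add: \<delta>_def less_divide_eq add_nonneg_pos)
      also have "\<dots> \<le> sqrt (1 + r\<^sup>2) * gdot g (e 0) tau"
        using e0 by (simp add: mult_le_cancel_right1)
      finally show ?thesis
        unfolding v_def sum_idx coord_def by (simp add: gdot_linear)
    qed
    ultimately show ?thesis
      using min[of "v r"] unfolding \<phi>[symmetric] \<open>v 0 = e 0\<close> by (simp add: future_unit_timelike_def)
  qed
  ultimately have "8 * (I1 + I2) = 0"
    using DERIV_local_min by blast
  then have "Im (\<Sum>n\<in>{1,2,3}. q 2 n * cnj (q 3 n)) = 0"
    by (simp add: sym' I1_def I2_def)
  then show ?thesis unfolding supermomentum_time(1)[OF sd] by simp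
qed

text \<open>A cyclic permutation of the spatial vectors is even and preserves orientation. It
  transfers results about \<open>e 1\<close> to the other two directions.\<close>

lemma cyclic_frame: "orthonormal_frame g (\<lambda>i. e (if i = 1 then 2 else if i = 2 then 3 else if i = 3 then 1 else 0))"
proof
  show "g $ a $ b = g $ b $ a" for a b by (rule metric_sym)
  have "\<forall>i j. gdot g (e (if i = 1 then 2 else if i = 2 then 3 else if i = 3 then 1 else 0))
     (e (if j = 1 then 2 else if j = 2 then 3 else if j = 3 then 1 else 0)) = mink i j"
    unfolding all_idx by (simp add: orthonormal mink_def)
  then show "gdot g (e (if i = 1 then 2 else if i = 2 then 3 else if i = 3 then 1 else 0))
     (e (if j = 1 then 2 else if j = 2 then 3 else if j = 3 then 1 else 0)) = mink i j" for i j
    by blast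
  show "det (\<chi> i. e (if i = 1 then 2 else if i = 2 then 3 else if i = 3 then 1 else 0)) > 0"
    using oriented by (simp add: det_idx algebra_simps)
qed

text \<open>Alignment makes the real and imaginary parts of \<open>q\<close> commute. Rotating the
  spatial frame to their common eigenbasis diagonalizes \<open>q\<close>.\<close>

lemma aligned_imp_canonical:
  assumes "weyl_tensor g C" and e0: "gdot g (e 0) tau > 0"
    and aligned: "ev (supermomentum g C (e 0)) (e 1) = 0" "ev (supermomentum g C (e 0)) (e 2) = 0"
      "ev (supermomentum g C (e 0)) (e 3) = 0"
  shows "\<exists>x y z s1 s2 s3. canonical_petrov_tetrad g tau C (e 0) x y z s1 s2 s3"
proof -
  obtain q where sym': "q 2 1 = q 1 2" "q 3 1 = q 1 3" "q 3 2 = q 2 3" and tr: "q 1 1 + q 2 2 + q 3 3 = 0"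
    and sd: "\<And>a b c d. sd_weyl g C a b c d = (\<Sum>m\<in>{1,2,3}. \<Sum>n\<in>{1,2,3}. q m n * biv m a b * biv n c d)"
    using sd_weyl_biv[OF assms(1)] by blast
  \<comment> \<open>Matches the three indices of the matrix type with the spatial indices 1, 2, 3 of
    \<open>idx\<close>.\<close>
  define idx_of :: "3 \<Rightarrow> idx" where "idx_of i = (if i = 1 then 1 else if i = 2 then 2 else 3)" for i
  define A :: "real^3^3" where "A = (\<chi> i j. Re (q (idx_of i) (idx_of j)))"
  define B :: "real^3^3" where "B = (\<chi> i j. Im (q (idx_of i) (idx_of j)))"
  have "transpose A = A" "transpose B = B"
    by (simp_all add: A_def B_def transpose_def vec_eq_iff forall_3 idx_of_def sym')
  \<comment> \<open>Up to sign, the off-diagonal entries of the commutator are the three imaginary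
    parts that vanish by alignment; its diagonal vanishes by symmetry.\<close>
  moreover have "A ** B = B ** A"
  proof -
    have "Im (\<Sum>n\<in>{1,2,3}. q 2 n * cnj (q 3 n)) = 0" "Im (\<Sum>n\<in>{1,2,3}. q 3 n * cnj (q 1 n)) = 0"
      "Im (\<Sum>n\<in>{1,2,3}. q 1 n * cnj (q 2 n)) = 0"
      using aligned unfolding supermomentum_time[OF sd] of_real_eq_0_iff by simp_all
    then show ?thesis
      unfolding vec_eq_iff forall_3 A_def B_def matrix_matrix_mult_def
      by (intro conjI; simp add: sum_3 idx_of_def sym' mult.commute[of "Im _" "Re _"]; linarith?)
  qed
  ultimately obtain b :: "3 \<Rightarrow> real^3" and k l where
    orth: "\<And>i j. b i \<bullet> b j = (if i = j then 1 else 0)" and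
    A: "\<And>m n. A $ m $ n = (\<Sum>i\<in>UNIV. k i * b i $ m * b i $ n)" and
    B: "\<And>m n. B $ m $ n = (\<Sum>i\<in>UNIV. l i * b i $ m * b i $ n)"
    by (rule commuting_symmetric_matrices_diagonalization) blast
  \<comment> \<open>The common eigenvectors turn the two real spectral expansions into one for
    \<open>q\<close> with complex eigenvalues \<open>s i\<close>.\<close>
  define s where "s i = Complex (k i) (l i)" for i
  have q: "q (idx_of m) (idx_of n) = (\<Sum>i\<in>UNIV. s i * complex_of_real (b i $ m) * complex_of_real (b i $ n))" for m n
    using A[of m n] B[of m n] by (simp add: A_def B_def complex_eq_iff s_def sum_3)
  define x where "x i = b i $ 1 *\<^sub>R e 1 + b i $ 2 *\<^sub>R e 2 + b i $ 3 *\<^sub>R e 3" for i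
  have orth': "b i $ 1 * b j $ 1 + b i $ 2 * b j $ 2 + b i $ 3 * b j $ 3 = (if i = j then 1 else 0)" for i j
    using orth[of i j] by (simp add: inner_vec_def sum_3)
  have gx: "gdot g (x i) (x j) = - (if i = j then 1 else 0)" for i j
    unfolding orth'[of i j, symmetric] x_def
    by (simp add: gdot_linear orthonormal mink_def algebra_simps)
  have g0: "gdot g (e 0) (x i) = 0" for i
    unfolding x_def by (simp add: gdot_linear orthonormal mink_def)
  have "s 1 + s 2 + s 3 = q 1 1 + q 2 2 + q 3 3"
  proof -
    have "q 1 1 + q 2 2 + q 3 3 = (\<Sum>i\<in>UNIV. s i * complex_of_real (b i $ 1 * b i $ 1 + b i $ 2 * b i $ 2 + b i $ 3 * b i $ 3))"
      using q[of 1 1] q[of 2 2] q[of 3 3] unfolding idx_of_def by (simp add: sum_3 algebra_simps)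
    then show ?thesis unfolding orth' by (simp add: sum_3)
  qed
  then have "s 1 + s 2 + s 3 = 0" using tr by simp
  \<comment> \<open>\<open>sd_wedge\<close> is linear in its second vector, so expanding the
    \<open>x i\<close> recovers the spectral expansion of \<open>q\<close>.\<close>
  moreover have "sd_weyl g C a b c d = s 1 * sd_wedge g (e 0) (x 1) a b * sd_wedge g (e 0) (x 1) c d
      + s 2 * sd_wedge g (e 0) (x 2) a b * sd_wedge g (e 0) (x 2) c d
      + s 3 * sd_wedge g (e 0) (x 3) a b * sd_wedge g (e 0) (x 3) c d" for a b c d
    unfolding sd x_def sd_wedge_add sd_wedge_scaleR
    using q[of 1 1] q[of 1 2] q[of 1 3] q[of 2 1] q[of 2 2] q[of 2 3] q[of 3 1] q[of 3 2] q[of 3 3]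
    unfolding idx_of_def by (simp add: sum_3 algebra_simps)
  ultimately have "canonical_petrov_tetrad g tau C (e 0) (x 1) (x 2) (x 3) (s 1) (s 2) (s 3)"
    using e0 gx g0 orthonormal[of 0 0]
    by (simp add: canonical_petrov_tetrad_def Let_def sd_wedge_def mink_def)
  then show ?thesis by blast
qed

end

text \<open>Criticality along \<open>e 1\<close> is applied to the frame and to its two cyclic
  rotations, all of which share the vector \<open>e 0\<close>.\<close>

lemma minimum_imp_aligned:
  assumes "orthonormal_frame g e" "weyl_tensor g C" "gdot g (e 0) tau > 0"
    and min: "\<And>t. future_unit_timelike g tau t \<Longrightarrow> br_quartic g C (e 0) \<le> br_quartic g C t"
  shows "ev (supermomentum g C (e 0)) (e 1) = 0" "ev (supermomentum g C (e 0)) (e 2) = 0"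
    "ev (supermomentum g C (e 0)) (e 3) = 0"
proof -
  note critical = orthonormal_frame.minimum_imp_critical[OF _ assms(2)]
  show "ev (supermomentum g C (e 0)) (e 1) = 0"
    by (rule critical) (use assms in auto)
  note cyc1 = orthonormal_frame.cyclic_frame[OF assms(1)]
  show "ev (supermomentum g C (e 0)) (e 2) = 0"
    using critical[OF cyc1] assms(3) min by simp
  show "ev (supermomentum g C (e 0)) (e 3) = 0"
    using critical[OF orthonormal_frame.cyclic_frame[OF cyc1]] assms(3) min by simp
qed

text \<open>Three distinct Petrov eigenvalues lie among \<open>- s1 / 2\<close>,
  \<open>- s2 / 2\<close>, \<open>- s3 / 2\<close>, so no two of these can coincide.\<close>

lemma canonical_imp_distinct:
  assumes "petrov_type_I g C" "orthonormal_frame g e"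
    "\<And>a b c d. sd_weyl g C a b c d = s1 * sd_wedge g (e 0) (e 1) a b * sd_wedge g (e 0) (e 1) c d
      + s2 * sd_wedge g (e 0) (e 2) a b * sd_wedge g (e 0) (e 2) c d
      + s3 * sd_wedge g (e 0) (e 3) a b * sd_wedge g (e 0) (e 3) c d"
  shows "s1 \<noteq> s2" "s2 \<noteq> s3" "s1 \<noteq> s3"
proof -
  obtain l1 l2 l3 where l: "l1 \<noteq> l2" "l1 \<noteq> l3" "l2 \<noteq> l3"
    "petrov_eigenvalue g C l1" "petrov_eigenvalue g C l2" "petrov_eigenvalue g C l3"
    using assms(1) unfolding petrov_type_I_def by blast
  have "l \<in> {- s1 / 2, - s2 / 2, - s3 / 2}" if "petrov_eigenvalue g C l" for l
    using orthonormal_frame.petrov_eigenvalue_cases[OF assms(2,3) that] by simp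
  from this[OF l(4)] this[OF l(5)] this[OF l(6)] l(1-3)
  show "s1 \<noteq> s2" "s2 \<noteq> s3" "s1 \<noteq> s3" by auto
qed

theorem theorem3:
  fixes g :: "real^4^4" and tau u :: "real^4" and C :: rtensor4
  assumes "lorentz_metric g"
    and "gdot g tau tau > 0"
    and "weyl_tensor g C"
    and "petrov_type_I g C"
    and "future_unit_timelike g tau u"
  shows
    "((\<forall>a b. (1/2) * (complex_of_real (lower g u a) *
              (\<Sum>c\<in>UNIV. \<Sum>d\<in>UNIV. \<Sum>e\<in>UNIV. bel_robinson g C b c d e * complex_of_real (u$c * u$d * u$e))
           - complex_of_real (lower g u b) *
              (\<Sum>c\<in>UNIV. \<Sum>d\<in>UNIV. \<Sum>e\<in>UNIV. bel_robinson g C a c d e * complex_of_real (u$c * u$d * u$e))) = 0)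
      \<longleftrightarrow> (\<exists>x y z s1 s2 s3. canonical_petrov_tetrad g tau C u x y z s1 s2 s3))
   \<and> ((\<exists>x y z s1 s2 s3. canonical_petrov_tetrad g tau C u x y z s1 s2 s3)
      \<longleftrightarrow> (\<forall>t. future_unit_timelike g tau t \<and> t \<noteq> u \<longrightarrow> br_quartic g C u < br_quartic g C t))
   \<and> (\<forall>v x y z s1 s2 s3. canonical_petrov_tetrad g tau C v x y z s1 s2 s3 \<longrightarrow>
        br_quartic g C v = (cmod s1 ^ 2 + cmod s2 ^ 2 + cmod s3 ^ 2) / 16 \<and>
        (\<forall>t. future_unit_timelike g tau t \<longrightarrow> br_quartic g C v \<le> br_quartic g C t))"
    (is "(?aligned \<longleftrightarrow> ?canonical) \<and> (_ \<longleftrightarrow> ?minimum) \<and> ?value")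
proof -
  have u: "gdot g u u = 1" "gdot g u tau > 0"
    using assms(5) by (auto simp: future_unit_timelike_def)
  obtain e where frame: "orthonormal_frame g e" and e0: "e 0 = u"
    using exists_orthonormal_frame[OF assms(1) u(1)] by blast
  have aligned_iff: "?aligned \<longleftrightarrow> ev (supermomentum g C u) (e' 1) = 0 \<and> ev (supermomentum g C u) (e' 2) = 0
      \<and> ev (supermomentum g C u) (e' 3) = 0" if "orthonormal_frame g e'" "e' 0 = u" for e'
    using orthonormal_frame.alignment_iff[OF that(1), of "supermomentum g C u"]
    unfolding supermomentum_def that(2) .
  \<comment> \<open>Stated for the time vector \<open>v\<close> of any canonical tetrad, this serves
    both the step from (ii) to (iii) and the clause on the minimum value.\<close>
  have canonical: "br_quartic g C v = (cmod s1 ^ 2 + cmod s2 ^ 2 + cmod s3 ^ 2) / 16 \<and>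
      (\<forall>t. future_unit_timelike g tau t \<and> t \<noteq> v \<longrightarrow> br_quartic g C v < br_quartic g C t)"
    if can: "canonical_petrov_tetrad g tau C v x y z s1 s2 s3" for v x y z s1 s2 s3
  proof -
    obtain e where e: "orthonormal_frame g e" "e 0 = v"
      and sd: "\<And>a b c d. sd_weyl g C a b c d = s1 * sd_wedge g (e 0) (e 1) a b * sd_wedge g (e 0) (e 1) c d
      + s2 * sd_wedge g (e 0) (e 2) a b * sd_wedge g (e 0) (e 2) c d
      + s3 * sd_wedge g (e 0) (e 3) a b * sd_wedge g (e 0) (e 3) c d"
      using canonical_petrov_tetrad_frame[OF assms(1) can] by metis
    have s: "s1 + s2 + s3 = 0" and v: "gdot g (e 0) tau > 0"
      using can e(2) by (auto simp: canonical_petrov_tetrad_def)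
    show ?thesis
      using orthonormal_frame.br_quartic_time[OF e(1) sd s]
        orthonormal_frame.br_quartic_strict_minimum[OF e(1) sd s canonical_imp_distinct[OF assms(4) e(1) sd] _ v]
      unfolding e(2) by blast
  qed
  \<comment> \<open>The equivalences are closed in the cycle (iii), (i), (ii), (iii).\<close>
  have "?aligned" if ?minimum
  proof -
    have "br_quartic g C (e 0) \<le> br_quartic g C t" if "future_unit_timelike g tau t" for t
      using \<open>?minimum\<close> that unfolding e0 by (cases "t = u") (auto intro: less_imp_le)
    from minimum_imp_aligned[OF frame assms(3) _ this] show ?thesis
      unfolding aligned_iff[OF frame e0] using u(2) by (simp add: e0)
  qed
  moreover have "?canonical" if "?aligned"
    using orthonormal_frame.aligned_imp_canonical[OF frame assms(3), of tau] u(2) that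
    unfolding aligned_iff[OF frame e0] e0 by blast
  moreover have "?minimum" if "?canonical" using that canonical by blast
  moreover have "?value" using canonical by (metis order_le_less)
  ultimately show ?thesis by blast
qed

end
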